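(* Let $X$ be a bisimplicial set. Then $$H_*\,\mathrm{Tot}(FX)\cong H_*\,\mathrm{Tot}\bigl(FX/F(D^h\cup D^v)\bigr).$$
   Context: For a bisimplicial set $X\colon\Delta^{\mathrm{op}}\times\Delta^{\mathrm{op}}\to\mathsf{Set}$, $FX$ is the double complex with $(FX)_{p,q}=\mathbb{Z}X_{p,q}$ (free abelian group), horizontal differential $\partial_h=\sum_i(-1)^i(d_i,\mathrm{id})$ and vertical differential $\partial_v=\sum_i(-1)^i(\mathrm{id},d_i)$. These commute; the total complex $\mathrm{Tot}$ has differential $\partial_v+(-1)^{\text{vertical degree}}\partial_h$. $D^h_{p,q}\subseteq X_{p,q}$ is the set of horizontally degenerate simplices, i.e. those of the form $(s_i,\mathrm{id})x$ with $x\in X_{p-1,q}$, and $D^v_{p,q}$ is the set of vertically degenerate simplices, i.e. those of the form $(\mathrm{id},s_i)x$ with $x\in X_{p,q-1}$. $F(D^h\cup D^v)$ is the sub-double complex of $FX$ with $F(D^h\cup D^v)_{p,q}=\mathbb{Z}(D^h_{p,q}\cup D^v_{p,q})$. *)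

theory Defs
  imports "HOL-Algebra.Free_Abelian_Groups"
begin

section \<open>The simplex category\<close>

text \<open>Monotone maps \<open>[m] \<rightarrow> [n]\<close>, where \<open>[n] = {0, \<dots>, n}\<close>. Extensionality on the source makes
  equality of HOL functions coincide with equality of maps; the identity of \<open>[n]\<close> is
  \<open>restrict id {..n}\<close>, and the composite of \<open>\<alpha>' : [l] \<rightarrow> [m]\<close> with \<open>\<alpha> : [m] \<rightarrow> [n]\<close> is
  \<open>compose {..l} \<alpha> \<alpha>'\<close>.\<close>

definition Delta_hom :: "nat \<Rightarrow> nat \<Rightarrow> (nat \<Rightarrow> nat) set" where
  "Delta_hom m n = {\<alpha> \<in> {..m} \<rightarrow>\<^sub>E {..n}. mono_on {..m} \<alpha>}"

definition Delta_id :: "nat \<Rightarrow> nat \<Rightarrow> nat" where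
  "Delta_id n = restrict id {..n}"

text \<open>\<open>coface n i : [n] \<rightarrow> [n + 1]\<close> for \<open>i \<le> n + 1\<close> is the injection missing \<open>i\<close>, and
  \<open>codegeneracy n i : [n + 1] \<rightarrow> [n]\<close> for \<open>i \<le> n\<close> is the surjection hitting \<open>i\<close> twice.\<close>

definition coface :: "nat \<Rightarrow> nat \<Rightarrow> nat \<Rightarrow> nat" where
  "coface n i = (\<lambda>j\<in>{..n}. if j < i then j else j + 1)"

definition codegeneracy :: "nat \<Rightarrow> nat \<Rightarrow> nat \<Rightarrow> nat" where
  "codegeneracy n i = (\<lambda>j\<in>{..n + 1}. if j \<le> i then j else j - 1)"

section \<open>Bisimplicial sets\<close>

text \<open>For \<open>\<alpha> : [m] \<rightarrow> [p]\<close> and \<open>\<beta> : [n] \<rightarrow> [q]\<close>, the map \<open>X(\<alpha>, \<beta>) : X\<^sub>p\<^sub>,\<^sub>q \<rightarrow> X\<^sub>m\<^sub>,\<^sub>n\<close> is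
  \<open>act X m p \<alpha> n q \<beta>\<close>. Source and target are passed explicitly because a HOL function does
  not determine its codomain, and the sets \<open>X\<^sub>p\<^sub>,\<^sub>q\<close> need not be disjoint. Only the values on
  \<open>X\<^sub>p\<^sub>,\<^sub>q\<close> matter.\<close>

record 'a bisimplicial =
  cells :: "nat \<Rightarrow> nat \<Rightarrow> 'a set"
  act :: "nat \<Rightarrow> nat \<Rightarrow> (nat \<Rightarrow> nat) \<Rightarrow> nat \<Rightarrow> nat \<Rightarrow> (nat \<Rightarrow> nat) \<Rightarrow> 'a \<Rightarrow> 'a"

definition bisimplicial_set :: "'a bisimplicial \<Rightarrow> bool" where
  "bisimplicial_set X \<longleftrightarrow>
     (\<forall>m p n q. \<forall>\<alpha>\<in>Delta_hom m p. \<forall>\<beta>\<in>Delta_hom n q.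
        act X m p \<alpha> n q \<beta> \<in> cells X p q \<rightarrow> cells X m n) \<and>
     (\<forall>p q. \<forall>x\<in>cells X p q. act X p p (Delta_id p) q q (Delta_id q) x = x) \<and>
     (\<forall>l m p k n q. \<forall>\<alpha>'\<in>Delta_hom l m. \<forall>\<alpha>\<in>Delta_hom m p.
        \<forall>\<beta>'\<in>Delta_hom k n. \<forall>\<beta>\<in>Delta_hom n q. \<forall>x\<in>cells X p q.
        act X l p (compose {..l} \<alpha> \<alpha>') k q (compose {..k} \<beta> \<beta>') x =
        act X l m \<alpha>' k n \<beta>' (act X m p \<alpha> n q \<beta> x))"

text \<open>Faces \<open>X\<^sub>p\<^sub>+\<^sub>1\<^sub>,\<^sub>q \<rightarrow> X\<^sub>p\<^sub>,\<^sub>q\<close> (\<open>i \<le> p + 1\<close>) and \<open>X\<^sub>p\<^sub>,\<^sub>q\<^sub>+\<^sub>1 \<rightarrow> X\<^sub>p\<^sub>,\<^sub>q\<close> (\<open>i \<le> q + 1\<close>);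
  degeneracies \<open>X\<^sub>p\<^sub>,\<^sub>q \<rightarrow> X\<^sub>p\<^sub>+\<^sub>1\<^sub>,\<^sub>q\<close> (\<open>i \<le> p\<close>) and \<open>X\<^sub>p\<^sub>,\<^sub>q \<rightarrow> X\<^sub>p\<^sub>,\<^sub>q\<^sub>+\<^sub>1\<close> (\<open>i \<le> q\<close>).\<close>

definition face_h :: "'a bisimplicial \<Rightarrow> nat \<Rightarrow> nat \<Rightarrow> nat \<Rightarrow> 'a \<Rightarrow> 'a" where
  "face_h X p q i = act X p (p + 1) (coface p i) q q (Delta_id q)"

definition face_v :: "'a bisimplicial \<Rightarrow> nat \<Rightarrow> nat \<Rightarrow> nat \<Rightarrow> 'a \<Rightarrow> 'a" where
  "face_v X p q i = act X p p (Delta_id p) q (q + 1) (coface q i)"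

definition degen_h :: "'a bisimplicial \<Rightarrow> nat \<Rightarrow> nat \<Rightarrow> nat \<Rightarrow> 'a \<Rightarrow> 'a" where
  "degen_h X p q i = act X (p + 1) p (codegeneracy p i) q q (Delta_id q)"

definition degen_v :: "'a bisimplicial \<Rightarrow> nat \<Rightarrow> nat \<Rightarrow> nat \<Rightarrow> 'a \<Rightarrow> 'a" where
  "degen_v X p q i = act X p p (Delta_id p) (q + 1) q (codegeneracy q i)"

definition degenerate_h :: "'a bisimplicial \<Rightarrow> nat \<Rightarrow> nat \<Rightarrow> 'a set" where
  "degenerate_h X p q = {degen_h X r q i x | r i x. p = r + 1 \<and> i \<le> r \<and> x \<in> cells X r q}"

definition degenerate_v :: "'a bisimplicial \<Rightarrow> nat \<Rightarrow> nat \<Rightarrow> 'a set" where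
  "degenerate_v X p q = {degen_v X p r i x | r i x. q = r + 1 \<and> i \<le> r \<and> x \<in> cells X p r}"

section \<open>Chain complexes and double complexes\<close>

text \<open>Differentials are indexed by the degree they map into:
  \<open>diff K n : K\<^sub>n\<^sub>+\<^sub>1 \<rightarrow> K\<^sub>n\<close>, \<open>diff_h C p q : C\<^sub>p\<^sub>+\<^sub>1\<^sub>,\<^sub>q \<rightarrow> C\<^sub>p\<^sub>,\<^sub>q\<close> and
  \<open>diff_v C p q : C\<^sub>p\<^sub>,\<^sub>q\<^sub>+\<^sub>1 \<rightarrow> C\<^sub>p\<^sub>,\<^sub>q\<close>. All groups in negative degrees are zero and are omitted,
  so every element of degree 0 is a cycle.\<close>

record 'b chain_complex =
  chain_grp :: "nat \<Rightarrow> 'b monoid"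
  diff :: "nat \<Rightarrow> 'b \<Rightarrow> 'b"

fun cycles :: "'b chain_complex \<Rightarrow> nat \<Rightarrow> 'b set" where
  "cycles K 0 = carrier (chain_grp K 0)"
| "cycles K (Suc n) = kernel (chain_grp K (Suc n)) (chain_grp K n) (diff K n)"

definition boundaries :: "'b chain_complex \<Rightarrow> nat \<Rightarrow> 'b set" where
  "boundaries K n = diff K n ` carrier (chain_grp K (n + 1))"

definition homology :: "nat \<Rightarrow> 'b chain_complex \<Rightarrow> 'b set monoid" where
  "homology n K = (chain_grp K n)\<lparr>carrier := cycles K n\<rparr> Mod boundaries K n"

record 'b double_complex =
  bigrp :: "nat \<Rightarrow> nat \<Rightarrow> 'b monoid"
  diff_h :: "nat \<Rightarrow> nat \<Rightarrow> 'b \<Rightarrow> 'b"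
  diff_v :: "nat \<Rightarrow> nat \<Rightarrow> 'b \<Rightarrow> 'b"

text \<open>On \<open>C\<^sub>a\<^sub>,\<^sub>b\<close> the total differential is \<open>\<partial>\<^sub>v + (-1)\<^sup>b \<partial>\<^sub>h\<close>. Hence the component in \<open>C\<^sub>p\<^sub>,\<^sub>q\<close> of the
  boundary of \<open>x\<close> receives \<open>\<partial>\<^sub>v\<close> from \<open>x\<^sub>p\<^sub>,\<^sub>q\<^sub>+\<^sub>1\<close> and \<open>(-1)\<^sup>q \<partial>\<^sub>h\<close> from \<open>x\<^sub>p\<^sub>+\<^sub>1\<^sub>,\<^sub>q\<close>.\<close>

definition Tot :: "'b double_complex \<Rightarrow> (nat \<times> nat \<Rightarrow> 'b) chain_complex" where
  "Tot C =
    \<lparr>chain_grp = (\<lambda>n. sum_group {(p, q). p + q = n} (\<lambda>(p, q). bigrp C p q)),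
     diff = (\<lambda>n x. \<lambda>(p, q)\<in>{(p, q). p + q = n}.
       diff_v C p q (x (p, q + 1)) \<otimes>\<^bsub>bigrp C p q\<^esub>
       (if even q then diff_h C p q (x (p + 1, q))
        else inv\<^bsub>bigrp C p q\<^esub> (diff_h C p q (x (p + 1, q)))))\<rparr>"

text \<open>The quotient of \<open>C\<close> by a sub-double complex \<open>B\<close>. If \<open>f : G \<rightarrow> G'\<close> maps the subgroup \<open>H\<close> into
  the subgroup \<open>H'\<close>, the induced map \<open>G/H \<rightarrow> G'/H'\<close> sends a coset \<open>Y\<close> to the coset \<open>H' + f(Y)\<close>.\<close>

definition quotient_complex ::
    "'b double_complex \<Rightarrow> 'b double_complex \<Rightarrow> 'b set double_complex" where
  "quotient_complex C B =
    \<lparr>bigrp = (\<lambda>p q. bigrp C p q Mod carrier (bigrp B p q)),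
     diff_h = (\<lambda>p q Y. carrier (bigrp B p q) <#>\<^bsub>bigrp C p q\<^esub> (diff_h C p q ` Y)),
     diff_v = (\<lambda>p q Y. carrier (bigrp B p q) <#>\<^bsub>bigrp C p q\<^esub> (diff_v C p q ` Y))\<rparr>"

section \<open>The free double complex\<close>

text \<open>The double complex with groups \<open>\<int>S\<^sub>p\<^sub>,\<^sub>q\<close>, for a family \<open>S\<close> of subsets of \<open>X\<close>, and with the
  differentials of \<open>FX\<close>; it is meaningful when these preserve the \<open>\<int>S\<^sub>p\<^sub>,\<^sub>q\<close>.\<close>

definition free_on ::
    "'a bisimplicial \<Rightarrow> (nat \<Rightarrow> nat \<Rightarrow> 'a set) \<Rightarrow> ('a \<Rightarrow>\<^sub>0 int) double_complex" where
  "free_on X S =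
    \<lparr>bigrp = (\<lambda>p q. free_Abelian_group (S p q)),
     diff_h = (\<lambda>p q. frag_extend (\<lambda>x. \<Sum>i\<le>p + 1. frag_cmul ((-1) ^ i) (frag_of (face_h X p q i x)))),
     diff_v = (\<lambda>p q. frag_extend (\<lambda>x. \<Sum>i\<le>q + 1. frag_cmul ((-1) ^ i) (frag_of (face_v X p q i x))))\<rparr>"

definition F :: "'a bisimplicial \<Rightarrow> ('a \<Rightarrow>\<^sub>0 int) double_complex" where
  "F X = free_on X (cells X)"

definition F_degenerate :: "'a bisimplicial \<Rightarrow> ('a \<Rightarrow>\<^sub>0 int) double_complex" where
  "F_degenerate X = free_on X (\<lambda>p q. degenerate_h X p q \<union> degenerate_v X p q)"

end

theory Submission
  imports Defs
begin

text \<open>It suffices that the total complex of \<open>F(D\<^sup>h \<union> D\<^sup>v)\<close> is acyclic. There, a cycle whose components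
  lie in the span of \<open>D\<^sup>h\<close> and of the \<open>s\<^sub>j\<close>-degenerate simplices for vertical \<open>s\<^sub>j\<close> with \<open>j \<le> k\<close> can be
  changed by the boundary of its image under the vertical operator \<open>(-1)\<^sup>k s\<^sub>k\<close> so that only \<open>j < k\<close>
  occur. Iterating pushes the cycle into \<open>F(D\<^sup>h)\<close>, and the same argument in the horizontal
  direction pushes it to zero.\<close>

section \<open>Surjective chain maps with acyclic kernel\<close>

text \<open>No single degeneracy contracts the degenerate complex. With \<open>t\<close> built from
  \<open>s_k\<close>, the operator \<open>\<partial>t + t\<partial>\<close> is the identity on
  \<open>s_k\<close>-degenerate simplices only up to \<open>s_j\<close>-degenerate ones with
  \<open>j < k\<close>, which forces the filtration by the index of the degeneracy. Since only
  cycles have to be filled, \<open>t\<close> need not be a chain homotopy on the whole complex: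
  subtracting the boundary of \<open>t z\<close> moves a cycle \<open>z\<close> one layer down, and
  the remainder is again a cycle. The filtration is finite in each total degree \<open>n\<close>,
  because the degeneracies \<open>s_j\<close> that land there have \<open>j < n\<close>. The two
  directions can be treated one after the other because D^h is stable under all vertical faces and
  degeneracies, so it is carried along while D^v is removed; afterwards only D^h is left for the
  horizontal degeneracies.\<close>

locale abelian_complex =
  fixes K :: "'b chain_complex"
  assumes comm: "\<And>n. comm_group (chain_grp K n)"
    and diff_hom: "\<And>n. diff K n \<in> hom (chain_grp K (Suc n)) (chain_grp K n)"
    and diff_diff: "\<And>n x. x \<in> carrier (chain_grp K (Suc (Suc n))) \<Longrightarrow>
      diff K n (diff K (Suc n) x) = \<one>\<^bsub>chain_grp K n\<^esub>"
begin

lemma diff_group_hom: "group_hom (chain_grp K (Suc n)) (chain_grp K n) (diff K n)"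
  using comm diff_hom by (simp add: group_hom_def group_hom_axioms_def comm_group.axioms(2))

lemma cycles_subgroup: "subgroup (cycles K n) (chain_grp K n)"
proof (cases n)
  case 0
  then show ?thesis by (simp add: group.subgroup_self comm comm_group.axioms(2))
next
  case (Suc m)
  then show ?thesis by (simp add: group_hom.subgroup_kernel diff_group_hom)
qed

abbreviation cycle_grp :: "nat \<Rightarrow> 'b monoid" where
  "cycle_grp n \<equiv> (chain_grp K n)\<lparr>carrier := cycles K n\<rparr>"

lemma cycle_grp_comm: "comm_group (cycle_grp n)"
proof -
  interpret G: comm_group "chain_grp K n" by (rule comm)
  interpret Z: subgroup "cycles K n" "chain_grp K n" by (rule cycles_subgroup)
  show ?thesis
    by (rule group.group_comm_groupI[OF Z.subgroup_is_group]) (auto simp: G.m_comm)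
qed

lemma boundaries_subset: "boundaries K n \<subseteq> cycles K n"
proof (cases n)
  case 0
  then show ?thesis using diff_hom[of 0] by (auto simp: boundaries_def hom_def)
next
  case (Suc m)
  then show ?thesis
    using diff_hom[of n] diff_diff[of _ m] by (auto simp: boundaries_def hom_def kernel_def)
qed

lemma boundaries_normal: "boundaries K n \<lhd> cycle_grp n"
proof -
  have "subgroup (boundaries K n) (chain_grp K n)"
    using group_hom.img_is_subgroup[OF diff_group_hom] by (simp add: boundaries_def)
  then have "subgroup (boundaries K n) (cycle_grp n)"
    using group.subgroup_incl[OF _ _ cycles_subgroup boundaries_subset] comm comm_group.axioms(2)
    by blast
  then show ?thesis
    by (rule comm_group.subgroup_imp_normal[OF cycle_grp_comm])
qed

end

text \<open>The diagram chase of the long exact homology sequence. The filling in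
  \<open>acyclic\<close> lies in the kernel of \<open>f\<close>, so chains can be corrected by it
  without changing their images.\<close>

lemma homology_iso_of_acyclic_kernel:
  fixes K :: "'b chain_complex" and L :: "'c chain_complex" and n :: nat
  assumes K: "abelian_complex K"
    and comm_L: "\<And>n. comm_group (chain_grp L n)"
    and hom_L: "\<And>n. diff L n \<in> hom (chain_grp L (Suc n)) (chain_grp L n)"
    and hom: "\<And>n. f n \<in> hom (chain_grp K n) (chain_grp L n)"
    and surj: "\<And>n. f n ` carrier (chain_grp K n) = carrier (chain_grp L n)"
    and chain_map: "\<And>n x. x \<in> carrier (chain_grp K (Suc n)) \<Longrightarrow>
      f n (diff K n x) = diff L n (f (Suc n) x)"
    and acyclic: "\<And>n x. \<lbrakk>x \<in> cycles K n; f n x = \<one>\<^bsub>chain_grp L n\<^esub>\<rbrakk> \<Longrightarrow>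
      \<exists>w\<in>carrier (chain_grp K (Suc n)). f (Suc n) w = \<one>\<^bsub>chain_grp L (Suc n)\<^esub> \<and> diff K n w = x"
  shows "homology n K \<cong> homology n L"
proof -
  interpret K: abelian_complex K by (rule K)
  have f_hom: "group_hom (chain_grp K n) (chain_grp L n) (f n)" for n
    using hom comm_L K.comm by (simp add: group_hom_def group_hom_axioms_def comm_group.axioms(2))
  interpret f: group_hom "chain_grp K i" "chain_grp L i" "f i" for i
    by (rule f_hom)
  interpret d: group_hom "chain_grp K (Suc i)" "chain_grp K i" "diff K i" for i
    by (rule K.diff_group_hom)
  \<comment> \<open>That the differential of \<open>L\<close> squares to zero descends from
    \<open>K\<close> along the surjection \<open>f\<close>.\<close>
  interpret L: abelian_complex L
  proof (rule abelian_complex.intro)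
    fix n y assume "y \<in> carrier (chain_grp L (Suc (Suc n)))"
    then obtain x where x: "x \<in> carrier (chain_grp K (Suc (Suc n)))" "y = f (Suc (Suc n)) x"
      using surj by blast
    then have "diff L n (diff L (Suc n) y) = f n (diff K n (diff K (Suc n) x))"
      by (simp add: chain_map)
    then show "diff L n (diff L (Suc n) y) = \<one>\<^bsub>chain_grp L n\<^esub>"
      using x by (simp add: K.diff_diff)
  qed (simp_all add: comm_L hom_L)
  interpret BL: normal "boundaries L i" "L.cycle_grp i" for i
    by (rule L.boundaries_normal)
  have cycles_sub: "x \<in> carrier (chain_grp K n)" if "x \<in> cycles K n" for x n
    using that K.cycles_subgroup subgroup.subset by blast
  have f_cycles: "f n x \<in> cycles L n" if "x \<in> cycles K n" for x n
  proof (cases n)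
    case 0
    then show ?thesis using that by simp
  next
    case (Suc m)
    then show ?thesis using that chain_map[of x m, symmetric] by (simp add: kernel_def)
  qed
  have f_bd: "f n x \<in> boundaries L n" if "x \<in> boundaries K n" for x n
    using that by (auto simp: boundaries_def chain_map)
  \<comment> \<open>Homology class of the image. Once \<open>g\<close> is onto with kernel the
    boundaries of \<open>K\<close>, the first isomorphism theorem finishes.\<close>
  define g where "g x = boundaries L n #>\<^bsub>L.cycle_grp n\<^esub> f n x" for x
  have hL: "homology n L = L.cycle_grp n Mod boundaries L n"
    by (simp add: homology_def)
  have "f n \<in> hom (K.cycle_grp n) (L.cycle_grp n)"
    using f_cycles cycles_sub by (auto simp: hom_def)
  from hom_compose[OF this BL.r_coset_hom_Mod]
  have "g \<in> hom (K.cycle_grp n) (homology n L)"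
    by (simp add: hL g_def[abs_def] o_def)
  then interpret g: group_hom "K.cycle_grp n" "homology n L" g
    by (simp add: group_hom_def group_hom_axioms_def hL BL.factorgroup_is_group
        comm_group.axioms(2)[OF K.cycle_grp_comm])
  have lift: "\<exists>x\<in>cycles K n. f n x = y" if y: "y \<in> cycles L n" for y
  proof -
    have "y \<in> carrier (chain_grp L n)"
      using y L.cycles_subgroup subgroup.subset by blast
    then obtain x where x: "x \<in> carrier (chain_grp K n)" "f n x = y"
      unfolding surj[symmetric] by (elim imageE) simp
    show ?thesis
    proof (cases n)
      case 0
      then show ?thesis using x by auto
    next
      case (Suc m)
      have "f m (diff K m x) = \<one>\<^bsub>chain_grp L m\<^esub>"
        using x y Suc by (simp add: chain_map kernel_def)
      moreover have "diff K m x \<in> cycles K m"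
        using K.boundaries_subset[of m] x Suc by (auto simp: boundaries_def)
      ultimately obtain w where w: "w \<in> carrier (chain_grp K n)" "f n w = \<one>\<^bsub>chain_grp L n\<^esub>"
          "diff K m w = diff K m x"
        using acyclic[of "diff K m x" m] Suc by auto
      \<comment> \<open>The preimage \<open>x\<close> has boundary \<open>diff K m x\<close>,
        perhaps nonzero. Dividing by \<open>w\<close>, which has the same boundary and trivial
        image, makes it a cycle over the same \<open>y\<close>.\<close>
      let ?x = "x \<otimes>\<^bsub>chain_grp K n\<^esub> inv\<^bsub>chain_grp K n\<^esub> w"
      have "?x \<in> cycles K n"
        using x w Suc by (simp add: kernel_def)
      moreover have "f n ?x = y"
        using x w by auto
      ultimately show ?thesis by blast
    qed
  qed
  have onto: "g ` carrier (K.cycle_grp n) = carrier (homology n L)"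
  proof -
    have "f n ` cycles K n = cycles L n"
      using lift f_cycles by blast
    then show ?thesis
      by (simp add: hL carrier_FactGroup g_def[abs_def] image_image[symmetric, of _ "f n"])
  qed
  have ker: "kernel (K.cycle_grp n) (homology n L) g = boundaries K n"
  proof (intro equalityI subsetI)
    fix x assume "x \<in> kernel (K.cycle_grp n) (homology n L) g"
    then have x: "x \<in> cycles K n" "boundaries L n #>\<^bsub>L.cycle_grp n\<^esub> f n x = boundaries L n"
      by (auto simp: kernel_def hL g_def)
    then have "f n x \<in> boundaries L n"
      using group.coset_join1[OF _ x(2)] f_cycles[of x n] BL.subgroup_axioms
        comm_group.axioms(2)[OF L.cycle_grp_comm] by simp
    then obtain y where y: "y \<in> carrier (chain_grp L (Suc n))" "f n x = diff L n y"
      by (auto simp: boundaries_def)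
    then obtain u where u: "u \<in> carrier (chain_grp K (Suc n))" "y = f (Suc n) u"
      unfolding surj[symmetric] by (elim imageE) simp
    \<comment> \<open>\<open>x\<close> and \<open>diff K n u\<close> have the same image, so their
      difference is a cycle in the kernel of \<open>f\<close> and hence a boundary; therefore so is
      \<open>x\<close>.\<close>
    let ?x = "x \<otimes>\<^bsub>chain_grp K n\<^esub> inv\<^bsub>chain_grp K n\<^esub> diff K n u"
    have du: "diff K n u \<in> cycles K n"
      using u K.boundaries_subset[of n] by (auto simp: boundaries_def)
    have "?x \<in> cycles K n"
      using x(1) du K.cycles_subgroup by (simp add: subgroup.m_closed subgroup.m_inv_closed)
    moreover have "f n (diff K n u) = f n x"
      using y u by (simp add: chain_map)
    then have "f n ?x = \<one>\<^bsub>chain_grp L n\<^esub>"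
      using u cycles_sub[OF x(1)] by simp
    ultimately obtain w where w: "w \<in> carrier (chain_grp K (Suc n))" "diff K n w = ?x"
      using acyclic[of ?x n] by auto
    have "diff K n (w \<otimes>\<^bsub>chain_grp K (Suc n)\<^esub> u) = x"
      using w u cycles_sub[OF x(1)] by (simp add: f.G.m_assoc)
    then show "x \<in> boundaries K n"
      using w(1) u(1) unfolding boundaries_def by (intro rev_image_eqI[of "w \<otimes>\<^bsub>chain_grp K (Suc n)\<^esub> u"]) simp_all
  next
    fix x assume "x \<in> boundaries K n"
    then show "x \<in> kernel (K.cycle_grp n) (homology n L) g"
      using K.boundaries_subset[of n] f_bd[of x n] BL.rcos_const comm_group.axioms(2)[OF L.cycle_grp_comm]
      by (auto simp: kernel_def hL g_def)
  qed
  show ?thesis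
    using g.FactGroup_iso[OF onto] unfolding ker homology_def[of n K] .
qed

section \<open>Quotients of double complexes\<close>

lemma finite_antidiagonal: "finite {(p, q). p + q = (n::nat)}"
  by (rule finite_subset[of _ "{..n} \<times> {..n}"]) auto

lemma set_mult_image_coset:
  assumes h: "group_hom G H h" and M: "subgroup M G" and N: "subgroup N H"
    and MN: "h ` M \<subseteq> N" and x: "x \<in> carrier G"
  shows "N <#>\<^bsub>H\<^esub> h ` (M #>\<^bsub>G\<^esub> x) = N #>\<^bsub>H\<^esub> h x"
proof -
  interpret group_hom G H h by (rule h)
  interpret M: subgroup M G by (rule M)
  interpret N: subgroup N H by (rule N)
  show ?thesis
  proof (intro equalityI subsetI)
    fix y assume "y \<in> N <#>\<^bsub>H\<^esub> h ` (M #>\<^bsub>G\<^esub> x)"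
    then obtain b m where y: "b \<in> N" "m \<in> M" "y = b \<otimes>\<^bsub>H\<^esub> h (m \<otimes>\<^bsub>G\<^esub> x)"
      by (auto simp: set_mult_def r_coset_def)
    then have "y = (b \<otimes>\<^bsub>H\<^esub> h m) \<otimes>\<^bsub>H\<^esub> h x"
      using x by (simp add: H.m_assoc)
    moreover have "b \<otimes>\<^bsub>H\<^esub> h m \<in> N"
      using y MN by (intro N.m_closed) auto
    ultimately show "y \<in> N #>\<^bsub>H\<^esub> h x"
      by (auto simp: r_coset_def)
  next
    fix y assume "y \<in> N #>\<^bsub>H\<^esub> h x"
    then obtain b where "b \<in> N" "y = b \<otimes>\<^bsub>H\<^esub> h x"
      by (auto simp: r_coset_def)
    moreover have "h x \<in> h ` (M #>\<^bsub>G\<^esub> x)"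
      using G.rcos_self[OF x M] by blast
    ultimately show "y \<in> N <#>\<^bsub>H\<^esub> h ` (M #>\<^bsub>G\<^esub> x)"
      unfolding set_mult_def by blast
  qed
qed

lemma induced_hom_Mod:
  assumes h: "group_hom G H h" and M: "M \<lhd> G" and N: "N \<lhd> H" and MN: "h ` M \<subseteq> N"
  shows "(\<lambda>Y. N <#>\<^bsub>H\<^esub> h ` Y) \<in> hom (G Mod M) (H Mod N)"
proof -
  interpret group_hom G H h by (rule h)
  interpret M: normal M G by (rule M)
  interpret N: normal N H by (rule N)
  have eq: "N <#>\<^bsub>H\<^esub> h ` (M #>\<^bsub>G\<^esub> x) = N #>\<^bsub>H\<^esub> h x" if "x \<in> carrier G" for x
    using set_mult_image_coset[OF h M.subgroup_axioms N.subgroup_axioms MN that] .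
  show ?thesis
    by (rule homI) (auto simp: carrier_FactGroup eq M.rcos_sum N.rcos_sum)
qed

text \<open>Just enough to make \<open>Tot\<close> a sequence of abelian groups and homomorphisms.
  That the total differential squares to zero enters as a hypothesis of
  \<open>homology_quotient_iso\<close> and comes from \<open>total_bd_total_bd\<close> for
  \<open>F X\<close>.\<close>

locale abelian_double_complex =
  fixes C :: "'b double_complex"
  assumes comm: "comm_group (bigrp C p q)"
    and diff_h_hom: "diff_h C p q \<in> hom (bigrp C (Suc p) q) (bigrp C p q)"
    and diff_v_hom: "diff_v C p q \<in> hom (bigrp C p (Suc q)) (bigrp C p q)"
begin

sublocale G: comm_group "bigrp C p q" for p q
  by (rule comm)

sublocale dh: group_hom "bigrp C (Suc p) q" "bigrp C p q" "diff_h C p q" for p q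
  by unfold_locales (rule diff_h_hom)

sublocale dv: group_hom "bigrp C p (Suc q)" "bigrp C p q" "diff_v C p q" for p q
  by unfold_locales (rule diff_v_hom)

text \<open>The finite support demanded by \<open>sum_group\<close> is automatic on a finite
  antidiagonal, which leaves the full product.\<close>

lemma carrier_Tot:
  "carrier (chain_grp (Tot C) n) = (\<Pi>\<^sub>E (p, q)\<in>{(p, q). p + q = n}. carrier (bigrp C p q))"
proof -
  have "group (case i of (p, q) \<Rightarrow> bigrp C p q)" for i
    by (simp split: prod.split)
  then show ?thesis
    using finite_antidiagonal[of n]
    by (auto simp: Tot_def carrier_sum_group PiE_iff extensional_def intro: rev_finite_subset)
qed

lemma Tot_component: "\<lbrakk>x \<in> carrier (chain_grp (Tot C) n); p + q = n\<rbrakk> \<Longrightarrow> x (p, q) \<in> carrier (bigrp C p q)"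
  by (auto simp: carrier_Tot PiE_iff)

lemma mult_Tot: "x \<otimes>\<^bsub>chain_grp (Tot C) n\<^esub> y =
    (\<lambda>(p, q)\<in>{(p, q). p + q = n}. x (p, q) \<otimes>\<^bsub>bigrp C p q\<^esub> y (p, q))"
  by (auto simp: Tot_def fun_eq_iff)

lemma one_Tot: "\<one>\<^bsub>chain_grp (Tot C) n\<^esub> = (\<lambda>(p, q)\<in>{(p, q). p + q = n}. \<one>\<^bsub>bigrp C p q\<^esub>)"
  by (auto simp: Tot_def fun_eq_iff)

lemma diff_Tot: "diff (Tot C) n x = (\<lambda>(p, q)\<in>{(p, q). p + q = n}.
    diff_v C p q (x (p, Suc q)) \<otimes>\<^bsub>bigrp C p q\<^esub>
    (if even q then diff_h C p q (x (Suc p, q)) else inv\<^bsub>bigrp C p q\<^esub> (diff_h C p q (x (Suc p, q)))))"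
  by (simp only: Tot_def chain_complex.simps Suc_eq_plus1)

lemma comm_group_Tot: "comm_group (chain_grp (Tot C) n)"
proof (rule group.group_comm_groupI)
  show "group (chain_grp (Tot C) n)"
    by (auto simp: Tot_def intro!: sum_group split: prod.split)
  show "x \<otimes>\<^bsub>chain_grp (Tot C) n\<^esub> y = y \<otimes>\<^bsub>chain_grp (Tot C) n\<^esub> x"
    if "x \<in> carrier (chain_grp (Tot C) n)" "y \<in> carrier (chain_grp (Tot C) n)" for x y
    using that by (auto simp: mult_Tot fun_eq_iff Tot_component G.m_comm)
qed

lemma diff_Tot_hom: "diff (Tot C) n \<in> hom (chain_grp (Tot C) (Suc n)) (chain_grp (Tot C) n)"
proof (rule homI)
  fix x assume "x \<in> carrier (chain_grp (Tot C) (Suc n))"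
  then show "diff (Tot C) n x \<in> carrier (chain_grp (Tot C) n)"
    by (auto simp: diff_Tot carrier_Tot PiE_iff)
next
  fix x y assume "x \<in> carrier (chain_grp (Tot C) (Suc n))" "y \<in> carrier (chain_grp (Tot C) (Suc n))"
  then show "diff (Tot C) n (x \<otimes>\<^bsub>chain_grp (Tot C) (Suc n)\<^esub> y) =
      diff (Tot C) n x \<otimes>\<^bsub>chain_grp (Tot C) n\<^esub> diff (Tot C) n y"
    by (auto simp: diff_Tot mult_Tot fun_eq_iff Tot_component G.inv_mult G.m_ac)
qed

end

locale double_subcomplex = abelian_double_complex C
  for C :: "'b double_complex" and B :: "'b double_complex" +
  assumes sub: "subgroup (carrier (bigrp B p q)) (bigrp C p q)"
    and diff_h_sub: "diff_h C p q ` carrier (bigrp B (Suc p) q) \<subseteq> carrier (bigrp B p q)"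
    and diff_v_sub: "diff_v C p q ` carrier (bigrp B p (Suc q)) \<subseteq> carrier (bigrp B p q)"
begin

sublocale N: normal "carrier (bigrp B p q)" "bigrp C p q" for p q
  by (rule G.subgroup_imp_normal[OF sub])

abbreviation proj :: "nat \<Rightarrow> nat \<Rightarrow> 'b \<Rightarrow> 'b set" where
  "proj p q x \<equiv> carrier (bigrp B p q) #>\<^bsub>bigrp C p q\<^esub> x"

sublocale Q: abelian_double_complex "quotient_complex C B"
proof (rule abelian_double_complex.intro)
  fix p q
  show "comm_group (bigrp (quotient_complex C B) p q)"
    by (simp add: quotient_complex_def G.abelian_FactGroup[OF sub])
  show "diff_h (quotient_complex C B) p q \<in>
      hom (bigrp (quotient_complex C B) (Suc p) q) (bigrp (quotient_complex C B) p q)"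
    using induced_hom_Mod[OF dh.group_hom_axioms N.normal_axioms N.normal_axioms diff_h_sub]
    by (simp add: quotient_complex_def)
  show "diff_v (quotient_complex C B) p q \<in>
      hom (bigrp (quotient_complex C B) p (Suc q)) (bigrp (quotient_complex C B) p q)"
    using induced_hom_Mod[OF dv.group_hom_axioms N.normal_axioms N.normal_axioms diff_v_sub]
    by (simp add: quotient_complex_def)
qed

lemma proj_hom: "proj p q \<in> hom (bigrp C p q) (bigrp (quotient_complex C B) p q)"
  using N.r_coset_hom_Mod by (simp add: quotient_complex_def)

sublocale pr: group_hom "bigrp C p q" "bigrp (quotient_complex C B) p q" "proj p q" for p q
  by unfold_locales (rule proj_hom)

lemma diff_h_proj:
  "x \<in> carrier (bigrp C (Suc p) q) \<Longrightarrow>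
    diff_h (quotient_complex C B) p q (proj (Suc p) q x) = proj p q (diff_h C p q x)"
  using set_mult_image_coset[OF dh.group_hom_axioms sub sub diff_h_sub]
  by (simp add: quotient_complex_def)

lemma diff_v_proj:
  "x \<in> carrier (bigrp C p (Suc q)) \<Longrightarrow>
    diff_v (quotient_complex C B) p q (proj p (Suc q) x) = proj p q (diff_v C p q x)"
  using set_mult_image_coset[OF dv.group_hom_axioms sub sub diff_v_sub]
  by (simp add: quotient_complex_def)

definition proj_Tot :: "nat \<Rightarrow> (nat \<times> nat \<Rightarrow> 'b) \<Rightarrow> nat \<times> nat \<Rightarrow> 'b set" where
  "proj_Tot n x = (\<lambda>(p, q)\<in>{(p, q). p + q = n}. proj p q (x (p, q)))"

lemma proj_Tot_hom:
  "proj_Tot n \<in> hom (chain_grp (Tot C) n) (chain_grp (Tot (quotient_complex C B)) n)"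
proof (rule homI)
  fix x assume "x \<in> carrier (chain_grp (Tot C) n)"
  then show "proj_Tot n x \<in> carrier (chain_grp (Tot (quotient_complex C B)) n)"
    by (auto simp: proj_Tot_def Q.carrier_Tot PiE_iff Tot_component)
next
  fix x y assume "x \<in> carrier (chain_grp (Tot C) n)" "y \<in> carrier (chain_grp (Tot C) n)"
  then show "proj_Tot n (x \<otimes>\<^bsub>chain_grp (Tot C) n\<^esub> y) =
      proj_Tot n x \<otimes>\<^bsub>chain_grp (Tot (quotient_complex C B)) n\<^esub> proj_Tot n y"
    by (auto simp: proj_Tot_def mult_Tot Q.mult_Tot fun_eq_iff Tot_component)
qed

lemma proj_Tot_surj:
  "proj_Tot n ` carrier (chain_grp (Tot C) n) = carrier (chain_grp (Tot (quotient_complex C B)) n)"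
proof (intro equalityI subsetI)
  fix Y assume Y: "Y \<in> carrier (chain_grp (Tot (quotient_complex C B)) n)"
  have "\<forall>(p, q)\<in>{(p, q). p + q = n}. \<exists>x. x \<in> carrier (bigrp C p q) \<and> proj p q x = Y (p, q)"
    using Q.Tot_component[OF Y] by (fastforce simp: quotient_complex_def carrier_FactGroup)
  then have "\<forall>i\<in>{(p, q). p + q = n}. \<exists>x. x \<in> carrier (bigrp C (fst i) (snd i)) \<and> proj (fst i) (snd i) x = Y i"
    by auto
  then obtain f where f: "\<forall>i\<in>{(p, q). p + q = n}.
      f i \<in> carrier (bigrp C (fst i) (snd i)) \<and> proj (fst i) (snd i) (f i) = Y i"
    by (rule bchoice[THEN exE])
  define x where "x = restrict f {(p, q). p + q = n}"
  have "x \<in> carrier (chain_grp (Tot C) n)"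
    using f by (auto simp: x_def carrier_Tot PiE_iff)
  moreover have "proj_Tot n x = Y"
    using f Y by (auto simp: x_def proj_Tot_def Q.carrier_Tot PiE_iff extensional_def fun_eq_iff)
  ultimately show "Y \<in> proj_Tot n ` carrier (chain_grp (Tot C) n)"
    by blast
qed (use proj_Tot_hom in \<open>auto simp: hom_def\<close>)

lemma proj_Tot_diff:
  assumes "x \<in> carrier (chain_grp (Tot C) (Suc n))"
  shows "proj_Tot n (diff (Tot C) n x) = diff (Tot (quotient_complex C B)) n (proj_Tot (Suc n) x)"
  using assms
  by (auto simp: proj_Tot_def diff_Tot Q.diff_Tot fun_eq_iff Tot_component diff_h_proj diff_v_proj)

lemma proj_Tot_eq_one_iff:
  assumes "x \<in> carrier (chain_grp (Tot C) n)"
  shows "proj_Tot n x = \<one>\<^bsub>chain_grp (Tot (quotient_complex C B)) n\<^esub> \<longleftrightarrow>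
    (\<forall>p q. p + q = n \<longrightarrow> x (p, q) \<in> carrier (bigrp B p q))"
proof -
  have "proj p q (x (p, q)) = carrier (bigrp B p q) \<longleftrightarrow> x (p, q) \<in> carrier (bigrp B p q)"
    if "p + q = n" for p q
    using G.coset_join1[OF _ Tot_component[OF assms that] sub] G.coset_join2[OF Tot_component[OF assms that] sub]
    by blast
  moreover have "\<one>\<^bsub>bigrp (quotient_complex C B) p q\<^esub> = carrier (bigrp B p q)" for p q
    by (simp add: quotient_complex_def)
  ultimately show ?thesis
    by (auto simp: proj_Tot_def Q.one_Tot fun_eq_iff)
qed

text \<open>Acyclicity of the subcomplex is phrased inside \<open>Tot C\<close>, through chains with
  all components in \<open>B\<close>. By \<open>proj_Tot_eq_one_iff\<close> these form the kernel of
  \<open>proj_Tot\<close>, so the total complex of \<open>B\<close> is never formed.\<close>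

theorem homology_quotient_iso:
  assumes diff_diff: "\<And>n x. x \<in> carrier (chain_grp (Tot C) (Suc (Suc n))) \<Longrightarrow>
      diff (Tot C) n (diff (Tot C) (Suc n) x) = \<one>\<^bsub>chain_grp (Tot C) n\<^esub>"
    and acyclic: "\<And>n x. \<lbrakk>x \<in> cycles (Tot C) n; \<And>p q. p + q = n \<Longrightarrow> x (p, q) \<in> carrier (bigrp B p q)\<rbrakk> \<Longrightarrow>
      \<exists>w\<in>carrier (chain_grp (Tot C) (Suc n)).
        (\<forall>p q. p + q = Suc n \<longrightarrow> w (p, q) \<in> carrier (bigrp B p q)) \<and> diff (Tot C) n w = x"
  shows "homology n (Tot C) \<cong> homology n (Tot (quotient_complex C B))"
proof (rule homology_iso_of_acyclic_kernel[where f = proj_Tot])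
  show K: "abelian_complex (Tot C)"
    by (rule abelian_complex.intro) (simp_all add: comm_group_Tot diff_Tot_hom diff_diff)
  fix n x assume x: "x \<in> cycles (Tot C) n" "proj_Tot n x = \<one>\<^bsub>chain_grp (Tot (quotient_complex C B)) n\<^esub>"
  have "x \<in> carrier (chain_grp (Tot C) n)"
    using x(1) abelian_complex.cycles_subgroup[OF K] subgroup.subset by blast
  then have "\<exists>w\<in>carrier (chain_grp (Tot C) (Suc n)).
      (\<forall>p q. p + q = Suc n \<longrightarrow> w (p, q) \<in> carrier (bigrp B p q)) \<and> diff (Tot C) n w = x"
    using x by (intro acyclic) (auto simp: proj_Tot_eq_one_iff)
  then show "\<exists>w\<in>carrier (chain_grp (Tot C) (Suc n)).
      proj_Tot (Suc n) w = \<one>\<^bsub>chain_grp (Tot (quotient_complex C B)) (Suc n)\<^esub> \<and> diff (Tot C) n w = x"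
    by (auto simp: proj_Tot_eq_one_iff)
qed (simp_all add: Q.comm_group_Tot Q.diff_Tot_hom proj_Tot_hom proj_Tot_surj proj_Tot_diff)

end

section \<open>Supports of elements of free abelian groups\<close>

lemma keys_add_subset: "Poly_Mapping.keys a \<subseteq> S \<Longrightarrow> Poly_Mapping.keys b \<subseteq> S \<Longrightarrow> Poly_Mapping.keys (a + b) \<subseteq> S"
  using keys_add[of a b] by blast

lemma keys_diff_subset: "Poly_Mapping.keys a \<subseteq> S \<Longrightarrow> Poly_Mapping.keys b \<subseteq> S \<Longrightarrow> Poly_Mapping.keys (a - b) \<subseteq> S"
  using keys_diff[of a b] by blast

lemma keys_cmul_subset: "Poly_Mapping.keys a \<subseteq> S \<Longrightarrow> Poly_Mapping.keys (frag_cmul c a) \<subseteq> S"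
  using keys_cmul by blast

lemma keys_sum_subset: "(\<And>i. i \<in> I \<Longrightarrow> Poly_Mapping.keys (f i) \<subseteq> S) \<Longrightarrow> Poly_Mapping.keys (sum f I) \<subseteq> S"
  using keys_sum[of f I] by blast

lemma keys_frag_extend_subset:
  assumes "Poly_Mapping.keys c \<subseteq> S" "\<And>x. x \<in> S \<Longrightarrow> Poly_Mapping.keys (f x) \<subseteq> T"
  shows "Poly_Mapping.keys (frag_extend f c) \<subseteq> T"
  using keys_frag_extend[of f c] assms by blast

lemma frag_cmul_diff_distrib2: "frag_cmul c (a - b) = frag_cmul c a - frag_cmul c b"
  by (simp add: poly_mapping_eqI lookup_minus right_diff_distrib)

lemmas keys_subset_intros =
  keys_add_subset keys_diff_subset keys_cmul_subset keys_sum_subset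

section \<open>Contracting degenerate simplices\<close>

text \<open>Indices are shifted by \<open>Suc\<close> to keep truncated subtraction out of the
  simplicial identities. Both directions of a bisimplicial set are instances, so the contraction is
  analysed only once.\<close>

locale simplicial =
  fixes Y :: "nat \<Rightarrow> 'a set" and d s :: "nat \<Rightarrow> nat \<Rightarrow> 'a \<Rightarrow> 'a"
  assumes d_in: "\<lbrakk>i \<le> Suc n; x \<in> Y (Suc n)\<rbrakk> \<Longrightarrow> d n i x \<in> Y n"
    and s_in: "\<lbrakk>i \<le> n; x \<in> Y n\<rbrakk> \<Longrightarrow> s n i x \<in> Y (Suc n)"
    and d_d: "\<lbrakk>i \<le> j; j \<le> Suc n; x \<in> Y (Suc (Suc n))\<rbrakk> \<Longrightarrow>
      d n i (d (Suc n) (Suc j) x) = d n j (d (Suc n) i x)"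
    and d_s_below: "\<lbrakk>i \<le> j; j \<le> n; x \<in> Y (Suc n)\<rbrakk> \<Longrightarrow>
      d (Suc n) i (s (Suc n) (Suc j) x) = s n j (d n i x)"
    and d_s_id: "\<lbrakk>j \<le> n; x \<in> Y n\<rbrakk> \<Longrightarrow> d n j (s n j x) = x"
    and d_s_id_Suc: "\<lbrakk>j \<le> n; x \<in> Y n\<rbrakk> \<Longrightarrow> d n (Suc j) (s n j x) = x"
    and d_s_above: "\<lbrakk>j < i; i \<le> Suc n; x \<in> Y (Suc n)\<rbrakk> \<Longrightarrow>
      d (Suc n) (Suc i) (s (Suc n) j x) = s n j (d n i x)"
    and s_s: "\<lbrakk>i \<le> j; j \<le> n; x \<in> Y n\<rbrakk> \<Longrightarrow> s (Suc n) (Suc j) (s n i x) = s (Suc n) i (s n j x)"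
begin

definition bd :: "nat \<Rightarrow> ('a \<Rightarrow>\<^sub>0 int) \<Rightarrow> ('a \<Rightarrow>\<^sub>0 int)" where
  "bd n = frag_extend (\<lambda>x. \<Sum>i\<le>n + 1. frag_cmul ((-1) ^ i) (frag_of (d n i x)))"

text \<open>The sign cancels the sign of the face \<open>d_k\<close>, so that the term
  \<open>s_k d_k s_k y = s_k y\<close> of \<open>t\<partial>\<close> has coefficient 1. The value 0
  covers degrees in which \<open>s_k\<close> does not exist.\<close>

definition contraction :: "nat \<Rightarrow> nat \<Rightarrow> ('a \<Rightarrow>\<^sub>0 int) \<Rightarrow> ('a \<Rightarrow>\<^sub>0 int)" where
  "contraction k n = frag_extend (\<lambda>x. if k \<le> n then frag_cmul ((-1) ^ k) (frag_of (s n k x)) else 0)"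

text \<open>A filtration of the degenerate simplices: empty for \<open>k = 0\<close>, and all of
  them as soon as \<open>n \<le> k\<close>.\<close>

definition degens :: "nat \<Rightarrow> nat \<Rightarrow> 'a set" where
  "degens k n = {s m j y | m j y. n = Suc m \<and> j \<le> m \<and> j < k \<and> y \<in> Y m}"

lemma bd_of: "bd n (frag_of x) = (\<Sum>i\<le>Suc n. frag_cmul ((-1) ^ i) (frag_of (d n i x)))"
  by (simp add: bd_def)

text \<open>The index pairs \<open>(j, i)\<close> with \<open>j \<le> i\<close> match the pairs
  \<open>(i + 1, j)\<close>: both give the same iterated face, with opposite signs.\<close>

lemma bd_bd_of:
  assumes x: "x \<in> Y (Suc (Suc n))"
  shows "bd n (bd (Suc n) (frag_of x)) = 0"
proof -
  define f where "f = (\<lambda>(j, i). frag_cmul ((-1) ^ (i + j)) (frag_of (d n i (d (Suc n) j x))))"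
  let ?A = "SIGMA j:{..Suc (Suc n)}. {i \<in> {..Suc n}. i < j}"
  let ?B = "SIGMA j:{..Suc (Suc n)}. {i \<in> {..Suc n}. j \<le> i}"
  have "bd n (bd (Suc n) (frag_of x)) = (\<Sum>j\<le>Suc (Suc n). \<Sum>i\<le>Suc n. f (j, i))"
    unfolding bd_of
    by (simp only: bd_def frag_extend_sum[OF finite_atMost] o_def frag_extend_cmul frag_extend_of
        frag_cmul_sum frag_cmul_cmul f_def case_prod_conv power_add Suc_eq_plus1 mult.commute)
  also have "\<dots> = sum f ({..Suc (Suc n)} \<times> {..Suc n})"
    by (simp only: sum.cartesian_product) simp
  also have "{..Suc (Suc n)} \<times> {..Suc n} = ?A \<union> ?B"
    by auto
  also have "sum f (?A \<union> ?B) = sum f ?A + sum f ?B"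
    by (rule sum.union_disjoint) auto
  also have "sum f ?B = (\<Sum>z\<in>?A. - f z)"
  proof (rule sum.reindex_bij_witness[where i = "\<lambda>(j, i). (i, j - 1)" and j = "\<lambda>(j, i). (Suc i, j)"])
    fix z assume "z \<in> ?B"
    then obtain j i where z: "z = (j, i)" "j \<le> i" "i \<le> Suc n" by auto
    show "- f (case z of (j, i) \<Rightarrow> (Suc i, j)) = f z"
      using d_d[OF z(2,3) x] by (simp add: f_def z(1) add.commute)
  qed auto
  finally show ?thesis
    by (simp add: sum_negf)
qed

lemma bd_bd:
  assumes "Poly_Mapping.keys c \<subseteq> Y (Suc (Suc n))"
  shows "bd n (bd (Suc n) c) = 0"
  using assms
proof (induction c rule: frag_induction)
  case (diff a b)
  then show ?case by (simp add: bd_def frag_extend_diff)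
qed (auto simp: bd_bd_of, simp add: bd_def)

text \<open>The faces \<open>k\<close> and \<open>k + 1\<close> both return \<open>x\<close> and
  cancel. The later ones are reindexed by one, hence the minus sign. For \<open>k = 0\<close> the
  truncated \<open>k - 1\<close> occurs only in an empty sum.\<close>

lemma bd_degen:
  assumes x: "x \<in> Y (Suc n)" and k: "k \<le> Suc n"
  shows "bd (Suc n) (frag_of (s (Suc n) k x)) =
    (\<Sum>i<k. frag_cmul ((-1) ^ i) (frag_of (s n (k - 1) (d n i x)))) -
    (\<Sum>i\<in>{k<..Suc n}. frag_cmul ((-1) ^ i) (frag_of (s n k (d n i x))))"
proof -
  let ?f = "\<lambda>i. frag_cmul ((-1) ^ i) (frag_of (d (Suc n) i (s (Suc n) k x)))"
  have split: "{..Suc (Suc n)} = {..<k} \<union> ({k, Suc k} \<union> {Suc k<..Suc (Suc n)})"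
    using k by auto
  have "bd (Suc n) (frag_of (s (Suc n) k x)) = sum ?f {..Suc (Suc n)}"
    by (rule bd_of)
  also have "\<dots> = sum ?f {..<k} + (sum ?f {k, Suc k} + sum ?f {Suc k<..Suc (Suc n)})"
    unfolding split by (subst sum.union_disjoint; (subst sum.union_disjoint)?; auto)
  also have "sum ?f {k, Suc k} = 0"
    using k x by (simp add: d_s_id d_s_id_Suc flip: minus_frag_cmul)
  also have "sum ?f {..<k} = (\<Sum>i<k. frag_cmul ((-1) ^ i) (frag_of (s n (k - 1) (d n i x))))"
  proof (rule sum.cong[OF refl])
    fix i assume "i \<in> {..<k}"
    then show "?f i = frag_cmul ((-1) ^ i) (frag_of (s n (k - 1) (d n i x)))"
      using d_s_below[of i "k - 1" n x] k x by auto
  qed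
  also have "sum ?f {Suc k<..Suc (Suc n)} =
      (\<Sum>i\<in>{k<..Suc n}. - frag_cmul ((-1) ^ i) (frag_of (s n k (d n i x))))"
  proof (rule sum.reindex_bij_witness[where i = Suc and j = "\<lambda>i. i - 1"])
    fix i assume i: "i \<in> {Suc k<..Suc (Suc n)}"
    then obtain j where "i = Suc j" by (cases i) auto
    then show "- frag_cmul ((-1) ^ (i - 1)) (frag_of (s n k (d n (i - 1) x))) = ?f i"
      using i d_s_above[of k j n x] x by auto
  qed auto
  finally show ?thesis
    by (simp add: sum_negf del: minus_frag_cmul)
qed

lemma degensI: "\<lbrakk>j \<le> n; j < k; y \<in> Y n\<rbrakk> \<Longrightarrow> s n j y \<in> degens k (Suc n)"
  by (auto simp: degens_def)

lemma degens_subset: "degens k n \<subseteq> Y n"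
  by (auto simp: degens_def s_in)

text \<open>The two faces that undo \<open>s_j\<close> cancel; by \<open>bd_degen\<close> the others
  are degenerate through \<open>s_(j-1)\<close> or \<open>s_j\<close>, so no index grows.\<close>

lemma bd_degens:
  assumes "Poly_Mapping.keys c \<subseteq> degens k (Suc n)"
  shows "Poly_Mapping.keys (bd n c) \<subseteq> degens k n"
proof -
  have "Poly_Mapping.keys (bd n (frag_of x)) \<subseteq> degens k n" if "x \<in> degens k (Suc n)" for x
  proof -
    obtain j y where x: "x = s n j y" "j \<le> n" "j < k" "y \<in> Y n"
      using \<open>x \<in> degens k (Suc n)\<close> by (auto simp: degens_def)
    show ?thesis
    proof (cases n)
      case 0
      then show ?thesis
        using x d_s_id[of 0 0 y] d_s_id_Suc[of 0 0 y] by (simp add: bd_of)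
    next
      case (Suc m)
      then show ?thesis
        using x by (simp only: bd_degen Suc) (intro keys_subset_intros; auto intro!: degensI d_in)
    qed
  qed
  then show ?thesis
    using assms unfolding bd_def by (intro keys_frag_extend_subset) auto
qed

text \<open>For \<open>j < k\<close> one has \<open>s_k s_j = s_j s_(k-1)\<close>, which brings the
  smaller index outermost.\<close>

lemma s_degens:
  assumes "x \<in> degens k n" "k \<le> n"
  shows "s n k x \<in> degens k (Suc n)"
proof -
  obtain m j y where x: "n = Suc m" "x = s m j y" "j \<le> m" "j < k" "y \<in> Y m"
    using \<open>x \<in> degens k n\<close> by (auto simp: degens_def)
  then have "s n k x = s n j (s m (k - 1) y)"
    using s_s[of j "k - 1" m y] \<open>k \<le> n\<close> by auto
  then show ?thesis
    using x \<open>k \<le> n\<close> by (auto intro!: degensI s_in)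
qed

lemma contraction_degens:
  assumes "Poly_Mapping.keys c \<subseteq> degens k n"
  shows "Poly_Mapping.keys (contraction k n c) \<subseteq> degens k (Suc n)"
  unfolding contraction_def by (intro keys_frag_extend_subset[OF assms]) (auto simp: s_degens)

text \<open>In \<open>\<partial>t x + t\<partial>x\<close> the faces above \<open>k\<close> cancel
  and the face \<open>k\<close> contributes \<open>x\<close> itself. What remains comes from faces
  \<open>i < k\<close>.\<close>

lemma contraction_top:
  assumes y: "y \<in> Y n" and k: "k \<le> n"
  defines "x \<equiv> s n k y"
  shows "Poly_Mapping.keys (frag_of x - bd (Suc n) (contraction k (Suc n) (frag_of x))
            - contraction k n (bd n (frag_of x))) \<subseteq> degens k (Suc n)"
proof -
  let ?g = "\<lambda>j i. frag_cmul ((-1) ^ i) (frag_of (s n j (d n i x)))"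
  have x: "x \<in> Y (Suc n)"
    using y k by (simp add: x_def s_in)
  have 1: "bd (Suc n) (contraction k (Suc n) (frag_of x)) =
      frag_cmul ((-1) ^ k) (sum (?g (k - 1)) {..<k} - sum (?g k) {k<..Suc n})"
    using k bd_degen[OF x, of k] by (simp add: contraction_def bd_def frag_extend_cmul)
  have 2: "contraction k n (bd n (frag_of x)) = frag_cmul ((-1) ^ k) (sum (?g k) {..Suc n})"
    using k unfolding bd_of contraction_def
    by (simp only: frag_extend_sum[OF finite_atMost] o_def frag_extend_cmul frag_extend_of
        frag_cmul_sum frag_cmul_cmul if_True mult.commute)
  have "{..Suc n} = {..<k} \<union> ({k} \<union> {k<..Suc n})"
    using k by auto
  then have 3: "sum (?g k) {..Suc n} = sum (?g k) {..<k} + (?g k k + sum (?g k) {k<..Suc n})"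
    by (simp only:) (subst sum.union_disjoint; (subst sum.union_disjoint)?; auto)
  have "?g k k = frag_cmul ((-1) ^ k) (frag_of x)"
    using y k by (simp add: x_def d_s_id)
  then have "frag_of x - bd (Suc n) (contraction k (Suc n) (frag_of x))
        - contraction k n (bd n (frag_of x)) =
      - frag_cmul ((-1) ^ k) (sum (?g (k - 1)) {..<k} + sum (?g k) {..<k})"
    unfolding 1 2 3
    by (simp add: frag_cmul_distrib2 frag_cmul_diff_distrib2 del: minus_frag_cmul flip: power_add)
  \<comment> \<open>The leftovers lie in the lower layer: the first visibly, the second because
    \<open>d_i s_k y = s_(k-1) d_i y\<close> already lies there and \<open>s_k\<close> preserves
    that layer.\<close>
  moreover have "s n (k - 1) (d n i x) \<in> degens k (Suc n)" "s n k (d n i x) \<in> degens k (Suc n)"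
    if i: "i < k" for i
  proof -
    show "s n (k - 1) (d n i x) \<in> degens k (Suc n)"
      using i k x by (intro degensI d_in) auto
    obtain m where n: "n = Suc m"
      using i k by (cases n) auto
    have "d n i x = s m (k - 1) (d m i y)"
      using d_s_below[of i "k - 1" m y] i k y by (auto simp: n x_def)
    then have "d n i x \<in> degens k n"
      using i k y by (auto simp: n intro!: degensI d_in)
    then show "s n k (d n i x) \<in> degens k (Suc n)"
      using k by (intro s_degens)
  qed
  ultimately show ?thesis
    by (simp only: keys_minus) (intro keys_subset_intros; auto)
qed

text \<open>For \<open>t = (-1)\<^sup>k s\<^sub>k\<close>, the operator \<open>\<partial>t + t\<partial>\<close> is the identity on \<open>s\<^sub>k\<close>-degenerate simplices modulo
  \<open>s\<^sub>j\<close>-degenerate ones with \<open>j < k\<close>, and it preserves the span of the latter. The subsimplicial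
  set \<open>E\<close> makes room for the simplices that are degenerate in the other direction.\<close>

lemma contraction_step:
  assumes E_sub: "\<And>m. E m \<subseteq> Y m"
    and E_d: "\<And>m i x. \<lbrakk>i \<le> Suc m; x \<in> E (Suc m)\<rbrakk> \<Longrightarrow> d m i x \<in> E m"
    and E_s: "\<And>m i x. \<lbrakk>i \<le> m; x \<in> E m\<rbrakk> \<Longrightarrow> s m i x \<in> E (Suc m)"
    and c: "Poly_Mapping.keys c \<subseteq> E n \<union> degens (Suc k) n"
  shows "Poly_Mapping.keys (c - bd n (contraction k n c)
      - (case n of 0 \<Rightarrow> 0 | Suc m \<Rightarrow> contraction k m (bd m c))) \<subseteq> E n \<union> degens k n"
    (is "Poly_Mapping.keys (?H c) \<subseteq> _")
proof -
  have bd_E: "Poly_Mapping.keys (bd m a) \<subseteq> E m" if "Poly_Mapping.keys a \<subseteq> E (Suc m)" for a m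
    unfolding bd_def
    by (rule keys_frag_extend_subset[OF that], intro keys_subset_intros) (auto intro: E_d)
  have con_E: "Poly_Mapping.keys (contraction k m a) \<subseteq> E (Suc m)" if "Poly_Mapping.keys a \<subseteq> E m" for a m
    unfolding contraction_def by (rule keys_frag_extend_subset[OF that]) (auto intro: E_s)
  have H_diff: "?H (a - b) = ?H a - ?H b" for a b
    by (simp add: bd_def contraction_def frag_extend_diff split: nat.split)
  show ?thesis
    using c
  proof (induction c rule: frag_induction)
    case zero
    then show ?case by (simp add: bd_def contraction_def split: nat.split)
  next
    case (diff a b)
    then show ?case unfolding H_diff by (rule keys_diff_subset)
  next
    case (one x)
    \<comment> \<open>\<open>E\<close> and the lower layer are each stable under both operators;
      only the new layer, degenerate through \<open>s_k\<close>, needs the cancellation of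
      \<open>contraction_top\<close>.\<close>
    consider "x \<in> E n" | "x \<in> degens k n" | m y where "n = Suc m" "x = s m k y" "k \<le> m" "y \<in> Y m"
      using one unfolding degens_def less_Suc_eq by blast
    then show ?case
    proof cases
      case 1
      then have "Poly_Mapping.keys (?H (frag_of x)) \<subseteq> E n"
        by (cases n) (simp_all add: keys_diff_subset bd_E con_E)
      then show ?thesis by blast
    next
      case 2
      then have "Poly_Mapping.keys (?H (frag_of x)) \<subseteq> degens k n"
        by (cases n) (simp_all add: keys_diff_subset bd_degens contraction_degens)
      then show ?thesis by blast
    next
      case 3
      then show ?thesis
        using contraction_top[of y m k] by (simp add: le_supI2)
    qed
  qed
qed

end

section \<open>The two simplicial directions\<close>

lemma Delta_id_in: "Delta_id n \<in> Delta_hom n n"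
  by (auto simp: Delta_id_def Delta_hom_def mono_on_def)

lemma coface_in: "i \<le> Suc n \<Longrightarrow> coface n i \<in> Delta_hom n (Suc n)"
  by (auto simp: coface_def Delta_hom_def mono_on_def)

lemma codegeneracy_in: "i \<le> n \<Longrightarrow> codegeneracy n i \<in> Delta_hom (Suc n) n"
  by (auto simp: codegeneracy_def Delta_hom_def mono_on_def)

lemma compose_Delta_id_left: "\<alpha> \<in> Delta_hom m n \<Longrightarrow> compose {..m} (Delta_id n) \<alpha> = \<alpha>"
  by (force simp: compose_def Delta_id_def Delta_hom_def PiE_iff extensional_def)

lemma compose_Delta_id_right: "\<alpha> \<in> Delta_hom m n \<Longrightarrow> compose {..m} \<alpha> (Delta_id m) = \<alpha>"
  by (force simp: compose_def Delta_id_def Delta_hom_def PiE_iff extensional_def)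

lemma coface_coface:
  "i \<le> j \<Longrightarrow> compose {..n} (coface (Suc n) (Suc j)) (coface n i) =
    compose {..n} (coface (Suc n) i) (coface n j)"
  by (auto simp: compose_def coface_def fun_eq_iff)

lemma codegeneracy_coface_below:
  "\<lbrakk>i \<le> j; j \<le> n\<rbrakk> \<Longrightarrow> compose {..Suc n} (codegeneracy (Suc n) (Suc j)) (coface (Suc n) i) =
    compose {..Suc n} (coface n i) (codegeneracy n j)"
  by (auto simp: compose_def coface_def codegeneracy_def fun_eq_iff)

lemma codegeneracy_coface_id: "compose {..n} (codegeneracy n j) (coface n j) = Delta_id n"
  by (auto simp: compose_def coface_def codegeneracy_def Delta_id_def fun_eq_iff)

lemma codegeneracy_coface_id_Suc: "compose {..n} (codegeneracy n j) (coface n (Suc j)) = Delta_id n"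
  by (auto simp: compose_def coface_def codegeneracy_def Delta_id_def fun_eq_iff)

lemma codegeneracy_coface_above:
  "\<lbrakk>j < i; i \<le> Suc n\<rbrakk> \<Longrightarrow> compose {..Suc n} (codegeneracy (Suc n) j) (coface (Suc n) (Suc i)) =
    compose {..Suc n} (coface n i) (codegeneracy n j)"
  by (auto simp: compose_def coface_def codegeneracy_def fun_eq_iff)

lemma codegeneracy_codegeneracy:
  "\<lbrakk>i \<le> j; j \<le> n\<rbrakk> \<Longrightarrow> compose {..Suc (Suc n)} (codegeneracy n i) (codegeneracy (Suc n) (Suc j)) =
    compose {..Suc (Suc n)} (codegeneracy n j) (codegeneracy (Suc n) i)"
  by (auto simp: compose_def codegeneracy_def fun_eq_iff)

text \<open>By contravariance each simplicial identity is one of the identities between cofaces and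
  codegeneracies above, with the composites reversed.\<close>

lemma simplicial_of_functor:
  assumes maps: "\<And>m p \<alpha> x. \<lbrakk>\<alpha> \<in> Delta_hom m p; x \<in> Y p\<rbrakk> \<Longrightarrow> A m p \<alpha> x \<in> Y m"
    and ident: "\<And>p x. x \<in> Y p \<Longrightarrow> A p p (Delta_id p) x = x"
    and comp: "\<And>l m p \<alpha> \<alpha>' x. \<lbrakk>\<alpha>' \<in> Delta_hom l m; \<alpha> \<in> Delta_hom m p; x \<in> Y p\<rbrakk> \<Longrightarrow>
      A l m \<alpha>' (A m p \<alpha> x) = A l p (compose {..l} \<alpha> \<alpha>') x"
  shows "simplicial Y (\<lambda>n i. A n (Suc n) (coface n i)) (\<lambda>n i. A (Suc n) n (codegeneracy n i))"
  by unfold_locales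
    (simp_all add: maps ident comp coface_in codegeneracy_in coface_coface codegeneracy_coface_below
      codegeneracy_coface_id codegeneracy_coface_id_Suc codegeneracy_coface_above
      codegeneracy_codegeneracy)

text \<open>An exchange of two finite sums. With \<open>J\<close> a singleton it also covers a
  differential in one direction against a contraction in the other.\<close>

lemma frag_extend_sum_commute:
  assumes c: "Poly_Mapping.keys c \<subseteq> S" and fin: "finite I" "finite J"
    and comm: "\<And>i j x. \<lbrakk>i \<in> I; j \<in> J; x \<in> S\<rbrakk> \<Longrightarrow> f i (g j x) = g' j (f' i x)"
  shows "frag_extend (\<lambda>x. \<Sum>i\<in>I. frag_cmul (a i) (frag_of (f i x)))
           (frag_extend (\<lambda>x. \<Sum>j\<in>J. frag_cmul (b j) (frag_of (g j x))) c) =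
         frag_extend (\<lambda>x. \<Sum>j\<in>J. frag_cmul (b j) (frag_of (g' j x)))
           (frag_extend (\<lambda>x. \<Sum>i\<in>I. frag_cmul (a i) (frag_of (f' i x))) c)"
  using c
proof (induction c rule: frag_induction)
  case (one x)
  have "(\<Sum>j\<in>J. \<Sum>i\<in>I. frag_cmul (b j * a i) (frag_of (f i (g j x)))) =
      (\<Sum>j\<in>J. \<Sum>i\<in>I. frag_cmul (a i * b j) (frag_of (g' j (f' i x))))"
    using one comm by (intro sum.cong refl) (simp add: mult.commute)
  also have "\<dots> = (\<Sum>i\<in>I. \<Sum>j\<in>J. frag_cmul (a i * b j) (frag_of (g' j (f' i x))))"
    by (rule sum.swap)
  finally show ?case
    using fin by (simp add: frag_extend_sum o_def frag_extend_cmul frag_cmul_sum)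
qed (simp_all add: frag_extend_diff)

section \<open>Interchange of horizontal and vertical operators\<close>

locale bisimplicial =
  fixes X :: "'a bisimplicial"
  assumes X: "bisimplicial_set X"
begin

lemma act_in:
  "\<lbrakk>\<alpha> \<in> Delta_hom m p; \<beta> \<in> Delta_hom n q; x \<in> cells X p q\<rbrakk> \<Longrightarrow> act X m p \<alpha> n q \<beta> x \<in> cells X m n"
  using X unfolding bisimplicial_set_def Pi_iff by metis

lemma act_id: "x \<in> cells X p q \<Longrightarrow> act X p p (Delta_id p) q q (Delta_id q) x = x"
  using X unfolding bisimplicial_set_def by blast

lemma act_act:
  "\<lbrakk>\<alpha>' \<in> Delta_hom l m; \<alpha> \<in> Delta_hom m p; \<beta>' \<in> Delta_hom k n; \<beta> \<in> Delta_hom n q; x \<in> cells X p q\<rbrakk> \<Longrightarrow>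
    act X l m \<alpha>' k n \<beta>' (act X m p \<alpha> n q \<beta> x) =
    act X l p (compose {..l} \<alpha> \<alpha>') k q (compose {..k} \<beta> \<beta>') x"
  using X unfolding bisimplicial_set_def by metis

text \<open>By functoriality both sides equal \<open>X(\<alpha>, \<beta>)\<close>. The four
  interchange laws for faces and degeneracies are instances.\<close>

lemma act_h_act_v:
  assumes "\<alpha> \<in> Delta_hom m p" "\<beta> \<in> Delta_hom n q" "x \<in> cells X p q"
  shows "act X m p \<alpha> n n (Delta_id n) (act X p p (Delta_id p) n q \<beta> x) =
    act X m m (Delta_id m) n q \<beta> (act X m p \<alpha> q q (Delta_id q) x)"
  using assms by (simp add: act_act Delta_id_in compose_Delta_id_left compose_Delta_id_right)

sublocale h: simplicial "\<lambda>p. cells X p q" "\<lambda>p. face_h X p q" "\<lambda>p. degen_h X p q" for q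
proof -
  have "simplicial (\<lambda>p. cells X p q) (\<lambda>n i. act X n (Suc n) (coface n i) q q (Delta_id q))
      (\<lambda>n i. act X (Suc n) n (codegeneracy n i) q q (Delta_id q))"
    by (rule simplicial_of_functor[where A = "\<lambda>m p \<alpha>. act X m p \<alpha> q q (Delta_id q)"])
      (simp_all add: act_in act_id act_act Delta_id_in compose_Delta_id_left)
  then show "simplicial (\<lambda>p. cells X p q) (\<lambda>p. face_h X p q) (\<lambda>p. degen_h X p q)"
    by (simp add: face_h_def[abs_def] degen_h_def[abs_def])
qed

sublocale v: simplicial "cells X p" "face_v X p" "degen_v X p" for p
proof -
  have "simplicial (cells X p) (\<lambda>n i. act X p p (Delta_id p) n (Suc n) (coface n i))
      (\<lambda>n i. act X p p (Delta_id p) (Suc n) n (codegeneracy n i))"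
    by (rule simplicial_of_functor[where A = "\<lambda>m q. act X p p (Delta_id p) m q"])
      (simp_all add: act_in act_id act_act Delta_id_in compose_Delta_id_left)
  then show "simplicial (cells X p) (face_v X p) (degen_v X p)"
    by (simp add: face_v_def[abs_def] degen_v_def[abs_def])
qed

abbreviation bdh :: "nat \<Rightarrow> nat \<Rightarrow> ('a \<Rightarrow>\<^sub>0 int) \<Rightarrow> ('a \<Rightarrow>\<^sub>0 int)" where
  "bdh p q \<equiv> simplicial.bd (\<lambda>p. face_h X p q) p"

abbreviation bdv :: "nat \<Rightarrow> nat \<Rightarrow> ('a \<Rightarrow>\<^sub>0 int) \<Rightarrow> ('a \<Rightarrow>\<^sub>0 int)" where
  "bdv p q \<equiv> simplicial.bd (face_v X p) q"

abbreviation conh :: "nat \<Rightarrow> nat \<Rightarrow> nat \<Rightarrow> ('a \<Rightarrow>\<^sub>0 int) \<Rightarrow> ('a \<Rightarrow>\<^sub>0 int)" where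
  "conh k p q \<equiv> simplicial.contraction (\<lambda>p. degen_h X p q) k p"

abbreviation conv :: "nat \<Rightarrow> nat \<Rightarrow> nat \<Rightarrow> ('a \<Rightarrow>\<^sub>0 int) \<Rightarrow> ('a \<Rightarrow>\<^sub>0 int)" where
  "conv k p q \<equiv> simplicial.contraction (degen_v X p) k q"

abbreviation degensh :: "nat \<Rightarrow> nat \<Rightarrow> nat \<Rightarrow> 'a set" where
  "degensh k p q \<equiv> simplicial.degens (\<lambda>p. cells X p q) (\<lambda>p. degen_h X p q) k p"

abbreviation degensv :: "nat \<Rightarrow> nat \<Rightarrow> nat \<Rightarrow> 'a set" where
  "degensv k p q \<equiv> simplicial.degens (cells X p) (degen_v X p) k q"

lemma face_h_face_v:
  "\<lbrakk>i \<le> Suc p; j \<le> Suc q; x \<in> cells X (Suc p) (Suc q)\<rbrakk> \<Longrightarrow>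
    face_h X p q i (face_v X (Suc p) q j x) = face_v X p q j (face_h X p (Suc q) i x)"
  by (simp add: face_h_def face_v_def act_h_act_v coface_in)

lemma face_h_degen_v:
  "\<lbrakk>i \<le> Suc p; j \<le> q; x \<in> cells X (Suc p) q\<rbrakk> \<Longrightarrow>
    face_h X p (Suc q) i (degen_v X (Suc p) q j x) = degen_v X p q j (face_h X p q i x)"
  by (simp add: face_h_def degen_v_def act_h_act_v coface_in codegeneracy_in)

lemma degen_h_face_v:
  "\<lbrakk>i \<le> p; j \<le> Suc q; x \<in> cells X p (Suc q)\<rbrakk> \<Longrightarrow>
    degen_h X p q i (face_v X p q j x) = face_v X (Suc p) q j (degen_h X p (Suc q) i x)"
  by (simp add: degen_h_def face_v_def act_h_act_v coface_in codegeneracy_in)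

lemma degen_h_degen_v:
  "\<lbrakk>i \<le> p; j \<le> q; x \<in> cells X p q\<rbrakk> \<Longrightarrow>
    degen_h X p (Suc q) i (degen_v X p q j x) = degen_v X (Suc p) q j (degen_h X p q i x)"
  by (simp add: degen_h_def degen_v_def act_h_act_v codegeneracy_in)

lemma bdh_bdv:
  assumes "Poly_Mapping.keys c \<subseteq> cells X (Suc p) (Suc q)"
  shows "bdh p q (bdv (Suc p) q c) = bdv p q (bdh p (Suc q) c)"
  unfolding h.bd_def v.bd_def
  by (rule frag_extend_sum_commute[OF assms]) (auto simp: face_h_face_v)

lemma bdh_conv:
  assumes "Poly_Mapping.keys c \<subseteq> cells X (Suc p) q"
  shows "bdh p (Suc q) (conv k (Suc p) q c) = conv k p q (bdh p q c)"
proof (cases "k \<le> q")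
  case True
  then show ?thesis
    unfolding h.bd_def v.contraction_def
    using frag_extend_sum_commute[OF assms, where I = "{..p + 1}" and J = "{k}"
        and f = "face_h X p (Suc q)" and f' = "face_h X p q" and g = "degen_v X (Suc p) q"
        and g' = "degen_v X p q" and a = "\<lambda>i. (-1) ^ i" and b = "\<lambda>i. (-1) ^ i"]
    by (simp add: face_h_degen_v)
qed (simp add: v.contraction_def h.bd_def frag_extend_eq_0)

lemma bdv_conh:
  assumes "Poly_Mapping.keys c \<subseteq> cells X p (Suc q)"
  shows "bdv (Suc p) q (conh k p (Suc q) c) = conh k p q (bdv p q c)"
proof (cases "k \<le> p")
  case True
  then show ?thesis
    unfolding v.bd_def h.contraction_def
    using frag_extend_sum_commute[OF assms, where I = "{..q + 1}" and J = "{k}"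
        and f = "face_v X (Suc p) q" and f' = "face_v X p q" and g = "degen_h X p (Suc q)"
        and g' = "degen_h X p q" and a = "\<lambda>i. (-1) ^ i" and b = "\<lambda>i. (-1) ^ i"]
    by (simp add: degen_h_face_v)
qed (simp add: h.contraction_def v.bd_def frag_extend_eq_0)

lemma degenerate_hI: "\<lbrakk>i \<le> p; x \<in> cells X p q\<rbrakk> \<Longrightarrow> degen_h X p q i x \<in> degenerate_h X (Suc p) q"
  unfolding degenerate_h_def by auto

lemma degenerate_vI: "\<lbrakk>i \<le> q; x \<in> cells X p q\<rbrakk> \<Longrightarrow> degen_v X p q i x \<in> degenerate_v X p (Suc q)"
  unfolding degenerate_v_def by auto

lemma degenerate_h_eq: "p \<le> k \<Longrightarrow> degenerate_h X p q = degensh k p q"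
  unfolding degenerate_h_def h.degens_def by fastforce

lemma degenerate_v_eq: "q \<le> k \<Longrightarrow> degenerate_v X p q = degensv k p q"
  unfolding degenerate_v_def v.degens_def by fastforce

lemma degenerate_h_subset: "degenerate_h X p q \<subseteq> cells X p q"
  by (simp add: degenerate_h_eq[OF order_refl] h.degens_subset)

lemma degenerate_v_subset: "degenerate_v X p q \<subseteq> cells X p q"
  by (simp add: degenerate_v_eq[OF order_refl] v.degens_subset)

text \<open>With \<open>degen_v_degenerate_h\<close> this makes D^h, for fixed \<open>p\<close>, a
  subsimplicial set in the vertical direction, as required of \<open>E\<close> in
  \<open>contraction_step\<close>.\<close>

lemma face_v_degenerate_h:
  "\<lbrakk>j \<le> Suc q; x \<in> degenerate_h X p (Suc q)\<rbrakk> \<Longrightarrow> face_v X p q j x \<in> degenerate_h X p q"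
  unfolding degenerate_h_def by (fastforce simp: v.d_in simp flip: degen_h_face_v)

lemma degen_v_degenerate_h:
  "\<lbrakk>j \<le> q; x \<in> degenerate_h X p q\<rbrakk> \<Longrightarrow> degen_v X p q j x \<in> degenerate_h X p (Suc q)"
  unfolding degenerate_h_def by (fastforce simp: v.s_in simp flip: degen_h_degen_v)

lemma face_h_degenerate_v:
  "\<lbrakk>i \<le> Suc p; x \<in> degenerate_v X (Suc p) q\<rbrakk> \<Longrightarrow> face_h X p q i x \<in> degenerate_v X p q"
  unfolding degenerate_v_def by (fastforce simp: h.d_in face_h_degen_v)

abbreviation degenerates :: "nat \<Rightarrow> nat \<Rightarrow> 'a set" where
  "degenerates p q \<equiv> degenerate_h X p q \<union> degenerate_v X p q"

end

section \<open>Acyclicity of the degenerate total complex\<close>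

context bisimplicial
begin

text \<open>Acts on families over all bidegrees, so that neither a degree nor a restriction to an
  antidiagonal has to be carried through the computations.\<close>

definition total_bd :: "(nat \<times> nat \<Rightarrow> 'a \<Rightarrow>\<^sub>0 int) \<Rightarrow> nat \<times> nat \<Rightarrow> 'a \<Rightarrow>\<^sub>0 int" where
  "total_bd z = (\<lambda>(p, q). bdv p q (z (p, Suc q)) + frag_cmul ((-1) ^ q) (bdh p q (z (Suc p, q))))"

definition chain :: "(nat \<Rightarrow> nat \<Rightarrow> 'a set) \<Rightarrow> nat \<Rightarrow> (nat \<times> nat \<Rightarrow> 'a \<Rightarrow>\<^sub>0 int) \<Rightarrow> bool" where
  "chain S n z \<longleftrightarrow> (\<forall>p q. p + q = n \<longrightarrow> Poly_Mapping.keys (z (p, q)) \<subseteq> S p q)"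

text \<open>Vacuous for \<open>n = 0\<close>, in agreement with \<open>cycles\<close>.\<close>

definition cycle :: "nat \<Rightarrow> (nat \<times> nat \<Rightarrow> 'a \<Rightarrow>\<^sub>0 int) \<Rightarrow> bool" where
  "cycle n z \<longleftrightarrow> (\<forall>p q. Suc (p + q) = n \<longrightarrow> total_bd z (p, q) = 0)"

lemma chainD: "\<lbrakk>chain S n z; p + q = n\<rbrakk> \<Longrightarrow> Poly_Mapping.keys (z (p, q)) \<subseteq> S p q"
  by (simp add: chain_def)

lemma chain_mono: "\<lbrakk>chain S n z; \<And>p q. S p q \<subseteq> T p q\<rbrakk> \<Longrightarrow> chain T n z"
  unfolding chain_def by blast

lemma bdv_add: "bdv p q (a + b) = bdv p q a + bdv p q b"
  by (simp add: v.bd_def frag_extend_add)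

lemma bdh_add: "bdh p q (a + b) = bdh p q a + bdh p q b"
  by (simp add: h.bd_def frag_extend_add)

lemma bdv_diff: "bdv p q (a - b) = bdv p q a - bdv p q b"
  by (simp add: v.bd_def frag_extend_diff)

lemma bdh_diff: "bdh p q (a - b) = bdh p q a - bdh p q b"
  by (simp add: h.bd_def frag_extend_diff)

lemma bdv_cmul: "bdv p q (frag_cmul k a) = frag_cmul k (bdv p q a)"
  by (simp add: v.bd_def frag_extend_cmul)

lemma bdh_cmul: "bdh p q (frag_cmul k a) = frag_cmul k (bdh p q a)"
  by (simp add: h.bd_def frag_extend_cmul)

lemma total_bd_diff: "total_bd (\<lambda>i. a i - b i) i = total_bd a i - total_bd b i"
  by (simp add: total_bd_def bdv_diff bdh_diff frag_cmul_diff_distrib2 split: prod.split)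

lemma total_bd_add: "total_bd (\<lambda>i. a i + b i) i = total_bd a i + total_bd b i"
  by (simp add: total_bd_def bdv_add bdh_add frag_cmul_distrib2 split: prod.split)

text \<open>The mixed terms carry the signs \<open>(-1)^(q+1)\<close> and \<open>(-1)^q\<close>, so
  they cancel because the two differentials commute.\<close>

lemma total_bd_total_bd:
  assumes "chain (cells X) (Suc (Suc n)) z" "p + q = n"
  shows "total_bd (total_bd z) (p, q) = 0"
proof -
  note z = chainD[OF assms(1)]
  have "bdv p q (bdv p (Suc q) (z (p, Suc (Suc q)))) = 0"
    using z assms(2) by (simp add: v.bd_bd)
  moreover have "bdh p q (bdh (Suc p) q (z (Suc (Suc p), q))) = 0"
    using z assms(2) by (simp add: h.bd_bd)
  moreover have "bdh p q (bdv (Suc p) q (z (Suc p, Suc q))) = bdv p q (bdh p (Suc q) (z (Suc p, Suc q)))"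
    using z assms(2) by (simp add: bdh_bdv)
  ultimately show ?thesis
    by (simp add: total_bd_def bdv_add bdh_add bdv_cmul bdh_cmul frag_cmul_distrib2 bdv_diff flip: minus_frag_cmul)
qed

lemma cycle_sub_total_bd:
  assumes "cycle n z" "chain (cells X) (Suc n) w"
  shows "cycle n (\<lambda>i. z i - total_bd w i)"
proof (cases n)
  case (Suc m)
  then show ?thesis
    using assms by (auto simp: cycle_def total_bd_diff total_bd_total_bd)
qed (simp add: cycle_def)

text \<open>The two kinds of simplices need different reasons, hence the splitting: every vertical
  face preserves D^h, whereas for D^v only the alternating sum stays degenerate.\<close>

lemma bdv_degenerates:
  assumes "Poly_Mapping.keys c \<subseteq> degenerates p (Suc q)"
  shows "Poly_Mapping.keys (bdv p q c) \<subseteq> degenerates p q"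
proof -
  obtain a b where a: "Poly_Mapping.keys a \<subseteq> degenerate_h X p (Suc q)"
    and b: "Poly_Mapping.keys b \<subseteq> degenerate_v X p (Suc q)" and c: "a + b = c"
    using frag_split[OF assms] .
  have "Poly_Mapping.keys (bdv p q a) \<subseteq> degenerate_h X p q"
    unfolding v.bd_def
    by (rule keys_frag_extend_subset[OF a], intro keys_subset_intros) (auto intro: face_v_degenerate_h)
  moreover have "Poly_Mapping.keys (bdv p q b) \<subseteq> degenerate_v X p q"
    using b v.bd_degens[of b p "Suc q" q] by (simp add: degenerate_v_eq[of _ "Suc q"])
  ultimately show ?thesis
    unfolding c[symmetric] bdv_add by (intro keys_add_subset) auto
qed

lemma bdh_degenerates:
  assumes "Poly_Mapping.keys c \<subseteq> degenerates (Suc p) q"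
  shows "Poly_Mapping.keys (bdh p q c) \<subseteq> degenerates p q"
proof -
  obtain a b where a: "Poly_Mapping.keys a \<subseteq> degenerate_h X (Suc p) q"
    and b: "Poly_Mapping.keys b \<subseteq> degenerate_v X (Suc p) q" and c: "a + b = c"
    using frag_split[OF assms] .
  have "Poly_Mapping.keys (bdh p q b) \<subseteq> degenerate_v X p q"
    unfolding h.bd_def
    by (rule keys_frag_extend_subset[OF b], intro keys_subset_intros) (auto intro: face_h_degenerate_v)
  moreover have "Poly_Mapping.keys (bdh p q a) \<subseteq> degenerate_h X p q"
    using a h.bd_degens[of a q "Suc p" p] by (simp add: degenerate_h_eq[of _ "Suc p"])
  ultimately show ?thesis
    unfolding c[symmetric] bdh_add by (intro keys_add_subset) auto
qed

text \<open>The vertical contraction \<open>T\<close> anticommutes with the horizontal part of the total differential,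
  because it raises the vertical degree by one. On a cycle, \<open>1 - \<partial>T\<close> therefore agrees with
  \<open>1 - \<partial>T - T\<partial>\<close>, and the latter involves the vertical direction only.\<close>

lemma vertical_step:
  assumes z: "chain (\<lambda>p q. degenerate_h X p q \<union> degensv (Suc k) p q) n z" and cyc: "cycle n z"
  shows "\<exists>w. chain degenerates (Suc n) w \<and>
    chain (\<lambda>p q. degenerate_h X p q \<union> degensv k p q) n (\<lambda>i. z i - total_bd w i)"
proof -
  \<comment> \<open>The contraction raises the vertical degree by one, so nothing lands in vertical
    degree 0.\<close>
  define w where "w = (\<lambda>(p, q). case q of 0 \<Rightarrow> 0 | Suc r \<Rightarrow> conv k p r (z (p, r)))"
  have z_sub: "Poly_Mapping.keys (z (p, q)) \<subseteq> degenerate_h X p q \<union> degensv (Suc k) p q"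
    if "p + q = n" for p q
    using chainD[OF z that] .
  have z_cells: "Poly_Mapping.keys (z (p, q)) \<subseteq> cells X p q" if "p + q = n" for p q
    using z_sub[OF that] degenerate_h_subset[of p q] v.degens_subset[of p "Suc k" q] by blast
  have "chain degenerates (Suc n) w"
    unfolding chain_def
  proof (intro allI impI)
    fix p q assume pq: "p + q = Suc n"
    show "Poly_Mapping.keys (w (p, q)) \<subseteq> degenerates p q"
    proof (cases q)
      case (Suc r)
      have "Poly_Mapping.keys (conv k p r (z (p, r))) \<subseteq> degenerate_v X p (Suc r)"
        unfolding v.contraction_def using z_cells[of p r] pq Suc
        by (intro keys_frag_extend_subset[where S = "cells X p r"]) (auto simp: degenerate_vI)
      then show ?thesis by (auto simp: w_def Suc)
    qed (simp add: w_def)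
  qed
  moreover have "chain (\<lambda>p q. degenerate_h X p q \<union> degensv k p q) n (\<lambda>i. z i - total_bd w i)"
    unfolding chain_def
  proof (intro allI impI)
    fix p q assume pq: "p + q = n"
    have "z (p, q) - total_bd w (p, q) = z (p, q) - bdv p q (conv k p q (z (p, q)))
        - (case q of 0 \<Rightarrow> 0 | Suc r \<Rightarrow> conv k p r (bdv p r (z (p, q))))"
    proof (cases q)
      case 0
      then show ?thesis by (simp add: total_bd_def w_def h.bd_def)
    next
      case (Suc r)
      \<comment> \<open>The cycle condition at \<open>(p, r)\<close>, of total degree
        \<open>n - 1\<close>. Its sign \<open>- (-1)^r\<close> is \<open>(-1)^q\<close>, the sign of
        the horizontal part of \<open>total_bd w\<close> at \<open>(p, q)\<close>.\<close>
      have "bdv p r (z (p, q)) = - frag_cmul ((-1) ^ r) (bdh p r (z (Suc p, r)))"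
        using cyc pq Suc unfolding cycle_def total_bd_def by (auto simp: eq_neg_iff_add_eq_0 simp del: minus_frag_cmul)
      then have "conv k p r (bdv p r (z (p, q))) = frag_cmul ((-1) ^ q) (conv k p r (bdh p r (z (Suc p, r))))"
        by (simp add: v.contraction_def frag_extend_cmul Suc)
      then show ?thesis
        using bdh_conv[OF z_cells[of "Suc p" r], of k] pq by (simp add: total_bd_def w_def Suc)
    qed
    moreover have "Poly_Mapping.keys (z (p, q) - bdv p q (conv k p q (z (p, q)))
        - (case q of 0 \<Rightarrow> 0 | Suc r \<Rightarrow> conv k p r (bdv p r (z (p, q)))))
      \<subseteq> degenerate_h X p q \<union> degensv k p q"
      by (rule v.contraction_step)
        (simp_all add: degenerate_h_subset face_v_degenerate_h degen_v_degenerate_h z_sub pq)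
    ultimately show "Poly_Mapping.keys (z (p, q) - total_bd w (p, q)) \<subseteq> degenerate_h X p q \<union> degensv k p q"
      by (simp only:)
  qed
  ultimately show ?thesis by blast
qed

text \<open>For the horizontal contraction \<open>T\<close>, the sign \<open>(-1)\<^sup>q\<close> makes \<open>T\<close> anticommute with the vertical differential and cancels the
  sign of the horizontal one.\<close>

lemma horizontal_step:
  assumes z: "chain (degensh (Suc k)) n z" and cyc: "cycle n z"
  shows "\<exists>w. chain degenerates (Suc n) w \<and> chain (degensh k) n (\<lambda>i. z i - total_bd w i)"
proof -
  define w where "w = (\<lambda>(p, q). case p of 0 \<Rightarrow> 0 | Suc r \<Rightarrow> frag_cmul ((-1) ^ q) (conh k r q (z (r, q))))"
  have z_sub: "Poly_Mapping.keys (z (p, q)) \<subseteq> degensh (Suc k) p q" if "p + q = n" for p q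
    using chainD[OF z that] .
  have z_cells: "Poly_Mapping.keys (z (p, q)) \<subseteq> cells X p q" if "p + q = n" for p q
    using z_sub[OF that] h.degens_subset[of q "Suc k" p] by blast
  have "chain degenerates (Suc n) w"
    unfolding chain_def
  proof (intro allI impI)
    fix p q assume pq: "p + q = Suc n"
    show "Poly_Mapping.keys (w (p, q)) \<subseteq> degenerates p q"
    proof (cases p)
      case (Suc r)
      have "Poly_Mapping.keys (conh k r q (z (r, q))) \<subseteq> degenerate_h X (Suc r) q"
        unfolding h.contraction_def using z_cells[of r q] pq Suc
        by (intro keys_frag_extend_subset[where S = "cells X r q"]) (auto simp: degenerate_hI)
      then show ?thesis by (auto simp: w_def Suc)
    qed (simp add: w_def)
  qed
  moreover have "chain (degensh k) n (\<lambda>i. z i - total_bd w i)"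
    unfolding chain_def
  proof (intro allI impI)
    fix p q assume pq: "p + q = n"
    have "z (p, q) - total_bd w (p, q) = z (p, q) - bdh p q (conh k p q (z (p, q)))
        - (case p of 0 \<Rightarrow> 0 | Suc r \<Rightarrow> conh k r q (bdh r q (z (p, q))))"
    proof (cases p)
      case 0
      then show ?thesis
        by (simp add: total_bd_def w_def v.bd_def h.bd_def frag_extend_cmul flip: power_add)
    next
      case (Suc r)
      have "bdv r q (z (r, Suc q)) + frag_cmul ((-1) ^ q) (bdh r q (z (p, q))) = 0"
        using cyc pq Suc unfolding cycle_def total_bd_def by auto
      then have "bdv r q (z (r, Suc q)) = - frag_cmul ((-1) ^ q) (bdh r q (z (p, q)))"
        by (simp add: eq_neg_iff_add_eq_0 del: minus_frag_cmul)
      then have "frag_cmul ((-1) ^ Suc q) (bdv r q (z (r, Suc q))) = bdh r q (z (p, q))"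
        by (simp flip: power_add)
      then have "frag_cmul ((-1) ^ Suc q) (conh k r q (bdv r q (z (r, Suc q)))) = conh k r q (bdh r q (z (p, q)))"
        unfolding h.contraction_def frag_extend_cmul[symmetric] by simp
      then show ?thesis
        using bdv_conh[OF z_cells[of r "Suc q"], of k] pq
        by (simp add: total_bd_def w_def Suc bdv_cmul bdh_cmul flip: power_add)
    qed
    moreover have "Poly_Mapping.keys (z (p, q) - bdh p q (conh k p q (z (p, q)))
        - (case p of 0 \<Rightarrow> 0 | Suc r \<Rightarrow> conh k r q (bdh r q (z (p, q)))))
      \<subseteq> {} \<union> degensh k p q"
      \<comment> \<open>The cycle now lies in the horizontal filtration alone, so there is nothing
        to carry along.\<close>
      by (rule h.contraction_step[where E = "\<lambda>_. {}"]) (simp_all add: z_sub pq)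
    ultimately show "Poly_Mapping.keys (z (p, q) - total_bd w (p, q)) \<subseteq> degensh k p q"
      by (simp only: Un_empty_left)
  qed
  ultimately show ?thesis by blast
qed

text \<open>The corrections of the successive steps add up to the filling. Each remainder is a cycle
  again by \<open>cycle_sub_total_bd\<close>, so the next step applies.\<close>

lemma fill_by_filtration:
  assumes base: "\<And>z. \<lbrakk>chain (S 0) n z; cycle n z\<rbrakk> \<Longrightarrow>
      \<exists>w. chain degenerates (Suc n) w \<and> (\<forall>p q. p + q = n \<longrightarrow> z (p, q) = total_bd w (p, q))"
    and step: "\<And>k z. \<lbrakk>chain (S (Suc k)) n z; cycle n z\<rbrakk> \<Longrightarrow>
      \<exists>w. chain degenerates (Suc n) w \<and> chain (S k) n (\<lambda>i. z i - total_bd w i)"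
    and z: "chain (S k) n z" "cycle n z"
  shows "\<exists>w. chain degenerates (Suc n) w \<and> (\<forall>p q. p + q = n \<longrightarrow> z (p, q) = total_bd w (p, q))"
  using z
proof (induction k arbitrary: z)
  case 0
  then show ?case by (rule base)
next
  case (Suc k)
  then obtain w where w: "chain degenerates (Suc n) w" "chain (S k) n (\<lambda>i. z i - total_bd w i)"
    using step by blast
  have "chain (cells X) (Suc n) w"
    using w(1) by (rule chain_mono) (simp add: degenerate_h_subset degenerate_v_subset)
  then obtain w' where w': "chain degenerates (Suc n) w'"
      "\<And>p q. p + q = n \<Longrightarrow> z (p, q) - total_bd w (p, q) = total_bd w' (p, q)"
    using Suc.IH[OF w(2) cycle_sub_total_bd[OF Suc.prems(2)]] by blast
  have "chain degenerates (Suc n) (\<lambda>i. w i + w' i)"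
    unfolding chain_def by (intro allI impI keys_add_subset chainD[OF w(1)] chainD[OF w'(1)])
  moreover have "z (p, q) = total_bd (\<lambda>i. w i + w' i) (p, q)" if "p + q = n" for p q
    using w'(2)[OF that] by (simp add: total_bd_add algebra_simps)
  ultimately show ?case by blast
qed

lemma degenerate_h_acyclic:
  assumes "chain (degenerate_h X) n z" "cycle n z"
  shows "\<exists>w. chain degenerates (Suc n) w \<and> (\<forall>p q. p + q = n \<longrightarrow> z (p, q) = total_bd w (p, q))"
\<comment> \<open>In total degree \<open>n\<close> the horizontal degree is at most
  \<open>n\<close>, so layer \<open>n\<close> contains all of D^h; a cycle in the empty layer 0
  vanishes.\<close>
proof (rule fill_by_filtration[where S = degensh and k = n])
  fix z assume "chain (degensh 0) n z"
  then have "z (p, q) = 0" if "p + q = n" for p q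
    using that by (auto simp: chain_def h.degens_def)
  then show "\<exists>w. chain degenerates (Suc n) w \<and> (\<forall>p q. p + q = n \<longrightarrow> z (p, q) = total_bd w (p, q))"
    by (intro exI[of _ "\<lambda>_. 0"]) (simp add: chain_def total_bd_def v.bd_def h.bd_def)
next
  show "chain (degensh n) n z"
    using assms(1) by (auto simp: chain_def degenerate_h_eq[of _ n])
qed (fact horizontal_step assms(2))+

text \<open>At layer 0 of the vertical filtration only D^h is left, and
  \<open>degenerate_h_acyclic\<close> takes over.\<close>

lemma degenerates_acyclic:
  assumes "chain degenerates n z" "cycle n z"
  shows "\<exists>w. chain degenerates (Suc n) w \<and> (\<forall>p q. p + q = n \<longrightarrow> z (p, q) = total_bd w (p, q))"
proof (rule fill_by_filtration[where S = "\<lambda>k p q. degenerate_h X p q \<union> degensv k p q" and k = n])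
  fix z assume z: "chain (\<lambda>p q. degenerate_h X p q \<union> degensv 0 p q) n z" "cycle n z"
  have "degensv 0 p q = {}" for p q
    by (simp add: v.degens_def)
  then show "\<exists>w. chain degenerates (Suc n) w \<and> (\<forall>p q. p + q = n \<longrightarrow> z (p, q) = total_bd w (p, q))"
    using z degenerate_h_acyclic[of n z] by (simp only: Un_empty_right)
next
  show "chain (\<lambda>p q. degenerate_h X p q \<union> degensv n p q) n z"
    using assms(1) by (auto simp: chain_def degenerate_v_eq[of _ n])
qed (fact vertical_step assms(2))+

end

section \<open>Normalisation of the total complex\<close>

context bisimplicial
begin

lemma bdv_cells: "Poly_Mapping.keys c \<subseteq> cells X p (Suc q) \<Longrightarrow> Poly_Mapping.keys (bdv p q c) \<subseteq> cells X p q"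
  unfolding v.bd_def
  by (rule keys_frag_extend_subset, assumption, intro keys_subset_intros) (auto intro: v.d_in)

lemma bdh_cells: "Poly_Mapping.keys c \<subseteq> cells X (Suc p) q \<Longrightarrow> Poly_Mapping.keys (bdh p q c) \<subseteq> cells X p q"
  unfolding h.bd_def
  by (rule keys_frag_extend_subset, assumption, intro keys_subset_intros) (auto intro: h.d_in)

lemma F_simps [simp]:
  "bigrp (F X) p q = free_Abelian_group (cells X p q)"
  "diff_h (F X) p q = bdh p q" "diff_v (F X) p q = bdv p q"
  "bigrp (F_degenerate X) p q = free_Abelian_group (degenerates p q)"
  by (simp_all add: F_def F_degenerate_def free_on_def h.bd_def v.bd_def)

lemma degenerates_subset: "degenerates p q \<subseteq> cells X p q"
  by (simp add: degenerate_h_subset degenerate_v_subset)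

lemma subgroup_degenerates:
  "subgroup (carrier (free_Abelian_group (degenerates p q))) (free_Abelian_group (cells X p q))"
proof
  show "carrier (free_Abelian_group (degenerates p q)) \<subseteq> carrier (free_Abelian_group (cells X p q))"
    by (intro subsetI) (simp only: carrier_free_Abelian_group_iff order_trans[OF _ degenerates_subset])
  show "inv\<^bsub>free_Abelian_group (cells X p q)\<^esub> x \<in> carrier (free_Abelian_group (degenerates p q))"
    if "x \<in> carrier (free_Abelian_group (degenerates p q))" for x
    using that degenerates_subset[of p q] by (subst inv_free_Abelian_group) auto
qed (simp_all add: keys_add_subset)

lemma double_subcomplex_degenerate: "double_subcomplex (F X) (F_degenerate X)"
proof (intro double_subcomplex.intro abelian_double_complex.intro double_subcomplex_axioms.intro)
  fix p q
  show "diff_h (F X) p q \<in> hom (bigrp (F X) (Suc p) q) (bigrp (F X) p q)"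
    by (intro homI) (simp_all add: bdh_add bdh_cells)
  show "diff_v (F X) p q \<in> hom (bigrp (F X) p (Suc q)) (bigrp (F X) p q)"
    by (intro homI) (simp_all add: bdv_add bdv_cells)
  show "diff_h (F X) p q ` carrier (bigrp (F_degenerate X) (Suc p) q) \<subseteq> carrier (bigrp (F_degenerate X) p q)"
    by (intro image_subsetI) (simp add: bdh_degenerates)
  show "diff_v (F X) p q ` carrier (bigrp (F_degenerate X) p (Suc q)) \<subseteq> carrier (bigrp (F_degenerate X) p q)"
    by (intro image_subsetI) (simp add: bdv_degenerates)
qed (simp_all add: abelian_free_Abelian_group subgroup_degenerates)

sublocale D: double_subcomplex "F X" "F_degenerate X"
  by (rule double_subcomplex_degenerate)

lemma carrier_Tot_F:
  "z \<in> carrier (chain_grp (Tot (F X)) n) \<longleftrightarrow>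
    chain (cells X) n z \<and> z \<in> extensional {(p, q). p + q = n}"
  by (auto simp: D.carrier_Tot PiE_iff chain_def)

lemma diff_Tot_F:
  assumes "chain (cells X) (Suc n) z"
  shows "diff (Tot (F X)) n z = restrict (total_bd z) {(p, q). p + q = n}"
proof -
  \<comment> \<open>Group inversion is rewritten to negation only on the carrier, so the horizontal
    boundary must be known to lie there.\<close>
  have "Poly_Mapping.keys (bdh p q (z (Suc p, q))) \<subseteq> cells X p q" if "p + q = n" for p q
    using that assms by (intro bdh_cells) (simp add: chain_def)
  then show ?thesis
    by (auto simp: D.diff_Tot total_bd_def fun_eq_iff)
qed

text \<open>Allows restrictions to an antidiagonal to be inserted and dropped under
  \<open>total_bd\<close>.\<close>

lemma total_bd_cong:
  "\<lbrakk>\<And>a b. a + b = Suc (p + q) \<Longrightarrow> z (a, b) = z' (a, b)\<rbrakk> \<Longrightarrow> total_bd z (p, q) = total_bd z' (p, q)"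
  by (simp add: total_bd_def)

lemma cycle_if_in_cycles:
  assumes "z \<in> cycles (Tot (F X)) n"
  shows "cycle n z"
proof (cases n)
  case (Suc m)
  then have z: "chain (cells X) (Suc m) z"
    and 0: "diff (Tot (F X)) m z = \<one>\<^bsub>chain_grp (Tot (F X)) m\<^esub>"
    using assms by (auto simp: kernel_def carrier_Tot_F)
  have "total_bd z (p, q) = 0" if "p + q = m" for p q
    using fun_cong[OF 0, of "(p, q)"] that by (simp add: diff_Tot_F[OF z] D.one_Tot)
  then show ?thesis by (simp add: cycle_def Suc)
qed (simp add: cycle_def)

lemma homology_quotient_degenerate:
  "homology n (Tot (F X)) \<cong> homology n (Tot (quotient_complex (F X) (F_degenerate X)))"
proof (rule D.homology_quotient_iso)
  fix n x assume x: "x \<in> carrier (chain_grp (Tot (F X)) (Suc (Suc n)))"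
  then have dx: "diff (Tot (F X)) (Suc n) x = restrict (total_bd x) {(p, q). p + q = Suc n}"
    by (simp add: carrier_Tot_F diff_Tot_F)
  have "diff (Tot (F X)) (Suc n) x \<in> carrier (chain_grp (Tot (F X)) (Suc n))"
    using x D.diff_Tot_hom[of "Suc n"] by (auto simp: hom_def)
  then have "diff (Tot (F X)) n (diff (Tot (F X)) (Suc n) x) =
      restrict (total_bd (diff (Tot (F X)) (Suc n) x)) {(p, q). p + q = n}"
    by (simp add: carrier_Tot_F diff_Tot_F)
  also have "\<dots> = restrict (total_bd (total_bd x)) {(p, q). p + q = n}"
    unfolding dx by (intro restrict_ext) (auto intro!: total_bd_cong)
  also have "\<dots> = \<one>\<^bsub>chain_grp (Tot (F X)) n\<^esub>"
    using x by (auto simp: D.one_Tot fun_eq_iff carrier_Tot_F total_bd_total_bd)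
  finally show "diff (Tot (F X)) n (diff (Tot (F X)) (Suc n) x) = \<one>\<^bsub>chain_grp (Tot (F X)) n\<^esub>" .
next
  fix n x
  assume x: "x \<in> cycles (Tot (F X)) n"
    and "\<And>p q. p + q = n \<Longrightarrow> x (p, q) \<in> carrier (bigrp (F_degenerate X) p q)"
  then have "chain degenerates n x"
    by (simp add: chain_def)
  then obtain w where w: "chain degenerates (Suc n) w"
      "\<And>p q. p + q = n \<Longrightarrow> x (p, q) = total_bd w (p, q)"
    using degenerates_acyclic cycle_if_in_cycles[OF x] by blast
  \<comment> \<open>\<open>w\<close> is arbitrary off the antidiagonal, whereas elements of the
    total group are extensional.\<close>
  define w' where "w' = restrict w {(p, q). p + q = Suc n}"
  have w': "chain degenerates (Suc n) w'"
    using w(1) by (simp add: chain_def w'_def)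
  then have "chain (cells X) (Suc n) w'"
    by (rule chain_mono) (rule degenerates_subset)
  moreover have "x \<in> extensional {(p, q). p + q = n}"
    using x by (cases n) (auto simp: kernel_def carrier_Tot_F)
  moreover have "total_bd w' (p, q) = x (p, q)" if "p + q = n" for p q
    using w(2)[OF that] that by (simp add: w'_def cong: total_bd_cong)
  ultimately have "diff (Tot (F X)) n w' = x"
    by (auto simp: diff_Tot_F fun_eq_iff extensional_def)
  moreover have "w' \<in> carrier (chain_grp (Tot (F X)) (Suc n))"
    using \<open>chain (cells X) (Suc n) w'\<close> by (simp add: carrier_Tot_F w'_def)
  ultimately show "\<exists>w\<in>carrier (chain_grp (Tot (F X)) (Suc n)).
      (\<forall>p q. p + q = Suc n \<longrightarrow> w (p, q) \<in> carrier (bigrp (F_degenerate X) p q)) \<and> diff (Tot (F X)) n w = x"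
    using w' by (intro bexI[of _ w']) (simp_all add: chain_def)
qed

end

theorem proposition8p4:
  fixes X :: "'a bisimplicial"
  assumes "bisimplicial_set X"
  shows "\<forall>n. homology n (Tot (F X)) \<cong> homology n (Tot (quotient_complex (F X) (F_degenerate X)))"
  using bisimplicial.homology_quotient_degenerate bisimplicial.intro[OF assms] by blast

end
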